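(* Let $\alpha,\alpha',\beta,\beta',\gamma,\rho,p,b,c\in\mathbb{C}$ be such that $\kappa:=p+\frac{b+1}{2}\notin\{0,-1,-2,\ldots\}$. Suppose that $\operatorname{Re}(\gamma)>0$ and $\operatorname{Re}(\rho-p)<1+\min\{\operatorname{Re}(-\beta),\operatorname{Re}(\alpha+\alpha'-\gamma),\operatorname{Re}(\alpha+\beta'-\gamma)\}$. Then for every $x>0$, $$\left(I_{0,-}^{\alpha,\alpha',\beta,\beta',\gamma}\,t^{\rho-1}\mathcal{W}_{p,b,c}(1/t)\right)(x)=\frac{x^{\rho-p-\alpha-\alpha'+\gamma-1}}{2^{p}}\;{}_3\psi_4\left[\begin{array}{c}(1-\rho+p-\gamma+\alpha+\alpha',2),\ (1-\rho+p+\alpha+\beta'-\gamma,2),\ (1-\rho+p-\beta,2)\\ (1-\rho+p,2),\ (1-\rho+p-\gamma+\alpha+\alpha'+\beta',2),\ (1-\rho+p+\alpha-\beta,2),\ (\kappa,1)\end{array}\bigg|-\frac{c}{4x^2}\right].$$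
   Context: Complex powers of positive reals are $y^{a}=\exp(a\log y)$. $(a)_n=a(a+1)\cdots(a+n-1)$, $(a)_0=1$, and $1/\Gamma$ is the entire reciprocal gamma function. Appell's third function (Horn's function) is $F_3(\alpha,\alpha',\beta,\beta';\gamma;u,v)=\sum_{m,n\ge0}\frac{(\alpha)_m(\alpha')_n(\beta)_m(\beta')_n}{(\gamma)_{m+n}\,m!\,n!}u^mv^n$ for $|u|,|v|<1$, extended by analytic continuation in $v$; explicitly, for $|u|<1$ and real $v<1$, $F_3=\sum_{m\ge0}\frac{(\alpha)_m(\beta)_m}{(\gamma)_m m!}u^m\,{}_2F_1(\alpha',\beta';\gamma+m;v)$, where ${}_2F_1$ is the Gauss hypergeometric function continued analytically to $\mathbb{C}\setminus[1,\infty)$. For $\operatorname{Re}(\gamma)>0$ and $x>0$, $$\left(I_{0,-}^{\alpha,\alpha',\beta,\beta',\gamma}f\right)(x)=\frac{x^{-\alpha'}}{\Gamma(\gamma)}\int_x^\infty(t-x)^{\gamma-1}t^{-\alpha}F_3\left(\alpha,\alpha',\beta,\beta';\gamma;1-\frac{x}{t},1-\frac{t}{x}\right)f(t)\,dt.$$ An expression in $t$ after the operator denotes the function $f(t)$ to which it is applied. The generalized Bessel function of the first kind is $\mathcal{W}_{p,b,c}(z)=\sum_{k=0}^\infty\frac{(-1)^kc^k}{\Gamma(p+\frac{b+1}{2}+k)\,k!}\left(\frac z2\right)^{2k+p}$. The generalized Wright function is ${}_r\psi_q\left[\begin{array}{c}(a_i,\alpha_i)_{1,r}\\(b_j,\beta_j)_{1,q}\end{array}\Big|z\right]=\sum_{k=0}^\infty\frac{\prod_{i=1}^r\Gamma(a_i+\alpha_ik)}{\prod_{j=1}^q\Gamma(b_j+\beta_jk)}\frac{z^k}{k!}$.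 *)

theory Defs
  imports "HOL-Complex_Analysis.Complex_Analysis"
begin

text \<open>The branch of the Gauss function \<open>\<^sub>2F\<^sub>1(a,b;c;\<cdot>)\<close> on \<open>\<complex> - [1,\<infinity>)\<close>: its values there are
  determined by the identity theorem, since the slit plane is connected.  The values on the cut
  (and everything, if \<open>c\<close> is a non-positive integer) are meaningless.\<close>

definition hyp2F1 :: "complex \<Rightarrow> complex \<Rightarrow> complex \<Rightarrow> complex \<Rightarrow> complex" where
  "hyp2F1 a b c = (SOME F. F holomorphic_on (- complex_of_real ` {1..}) \<and>
     (\<forall>z. norm z < 1 \<longrightarrow>
        (\<lambda>n. pochhammer a n * pochhammer b n / (pochhammer c n * fact n) * z ^ n) sums F z))"

text \<open>Appell's \<open>F\<^sub>3\<close> for \<open>\<bar>u\<bar> < 1\<close> and \<open>v \<notin> [1,\<infinity>)\<close>.  Because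
  \<open>(\<gamma>)\<^bsub>m+n\<^esub> = (\<gamma>)\<^sub>m (\<gamma> + m)\<^sub>n\<close>, summing the double series over \<open>n\<close> first gives the series below for
  \<open>\<bar>v\<bar> < 1\<close>; with \<open>hyp2F1\<close> as its coefficients it is also the continuation in \<open>v\<close>.\<close>

definition appell_F3 ::
  "complex \<Rightarrow> complex \<Rightarrow> complex \<Rightarrow> complex \<Rightarrow> complex \<Rightarrow> complex \<Rightarrow> complex \<Rightarrow> complex" where
  "appell_F3 \<alpha> \<alpha>' \<beta> \<beta>' \<gamma> u v =
     (\<Sum>m. pochhammer \<alpha> m * pochhammer \<beta> m / (pochhammer \<gamma> m * fact m) * u ^ m
            * hyp2F1 \<alpha>' \<beta>' (\<gamma> + of_nat m) v)"

definition msm_integrand ::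
  "complex \<Rightarrow> complex \<Rightarrow> complex \<Rightarrow> complex \<Rightarrow> complex \<Rightarrow> (real \<Rightarrow> complex) \<Rightarrow> real \<Rightarrow> real \<Rightarrow> complex"
where
  "msm_integrand \<alpha> \<alpha>' \<beta> \<beta>' \<gamma> f x t =
     of_real (t - x) powr (\<gamma> - 1) * of_real t powr (- \<alpha>)
     * appell_F3 \<alpha> \<alpha>' \<beta> \<beta>' \<gamma> (of_real (1 - x / t)) (of_real (1 - t / x)) * f t"

text \<open>The right-sided Marichev--Saigo--Maeda operator \<open>I\<^bsub>0,-\<^esub>\<close>.\<close>

definition msm_integral ::
  "complex \<Rightarrow> complex \<Rightarrow> complex \<Rightarrow> complex \<Rightarrow> complex \<Rightarrow> (real \<Rightarrow> complex) \<Rightarrow> real \<Rightarrow> complex"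
where
  "msm_integral \<alpha> \<alpha>' \<beta> \<beta>' \<gamma> f x =
     of_real x powr (- \<alpha>') / Gamma \<gamma>
     * (LINT t:{x<..}|lborel. msm_integrand \<alpha> \<alpha>' \<beta> \<beta>' \<gamma> f x t)"

text \<open>Powers are principal ones; note that \<open>0 powr 0 = 0\<close>, so \<open>z = 0\<close> is to be avoided.\<close>

definition gen_bessel :: "complex \<Rightarrow> complex \<Rightarrow> complex \<Rightarrow> complex \<Rightarrow> complex" where
  "gen_bessel p b c z =
     (\<Sum>k. (-1) ^ k * c ^ k * rGamma (p + (b + 1) / 2 + of_nat k) / fact k
            * (z / 2) powr (2 * of_nat k + p))"

definition wright_psi ::
  "(complex \<times> real) list \<Rightarrow> (complex \<times> real) list \<Rightarrow> complex \<Rightarrow> complex" where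
  "wright_psi as bs z =
     (\<Sum>k. (\<Prod>(a, A)\<leftarrow>as. Gamma (a + of_real A * of_nat k))
            * (\<Prod>(b, B)\<leftarrow>bs. rGamma (b + of_real B * of_nat k)) * z ^ k / fact k)"

end

theory Submission
  imports Defs
begin

text \<open>
  The function \<open>t powr (\<rho> - 1) * gen_bessel p b c (1 / t)\<close> is a convergent sum of powers
  \<open>t powr (\<rho> - p - 1 - 2 * k)\<close>, so the theorem is the image of a single power under the operator,
  summed over \<open>k\<close>.  On the range \<open>t > x\<close> the extra factor \<open>t powr (- 2 * k)\<close> is at most
  \<open>x powr (- 2 * k)\<close>; integrability for \<open>k = 0\<close> therefore dominates the whole sum, and each term
  produces one term of the Wright series.

  For a power (\<open>appell_integral\<close>), insert the series of \<open>F\<^sub>3\<close> in \<open>u = 1 - x / t\<close>.  Its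
  coefficients are Gauss functions at the negative point \<open>v = 1 - t / x\<close>, and Pfaff's transformation
  turns these into power series in \<open>v / (v - 1)\<close>, which is again \<open>u\<close>.  What is left is a double sum of
  Beta integrals over \<open>{x<..}\<close>.  Both summations are carried out by Gauss's theorem at the point 1
  (\<open>gauss_sum\<close>): the inner one consumes the parameters \<open>\<alpha>'\<close>, \<open>\<beta>'\<close> and the outer one \<open>\<alpha>\<close>, \<open>\<beta>\<close>.  Gauss's
  theorem is used with \<open>1 / \<Gamma>\<close> in place of the lower Pochhammer symbols, because the lower parameter
  of the outer sum may be a non-positive integer.

  The double sum converges absolutely if \<open>Re \<alpha>' > 0\<close>, but in general not otherwise, and this
  positivity is not among the hypotheses.  The general case follows by descent: a contiguous
  relation of the Gauss function expresses the integrand for \<open>(\<alpha>', \<beta>', \<gamma>)\<close> by those for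
  \<open>(\<alpha>' + 1, \<beta>', \<gamma>)\<close> and \<open>(\<alpha>' + 1, \<beta>' + 1, \<gamma> + 1)\<close>, with the same powers of \<open>t\<close>, and the right-hand
  sides satisfy the same relation (\<open>appell_integral_law_step\<close>).  In the absolutely convergent case
  the estimate replaces the parameters by slightly larger real ones, so that the majorant is
  itself summed exactly by Gauss's theorem (\<open>summable_double_gauss\<close>).

  All of this needs the branch \<open>hyp2F1\<close> to exist and to satisfy Pfaff's transformation.  If
  \<open>Re b > 1\<close> and \<open>Re (c - b) > 1\<close> both facts come from Euler's integral, whose integrand is then
  continuous up to the end points; two contiguous relations, each compatible with Pfaff's
  transformation, extend them to all parameters with \<open>Re c > 0\<close> (\<open>branch_exists\<close>).
\<close>

section \<open>Gauss's summation theorem in regularised form\<close>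

lemma not_nonpos_Int_if_Re_pos: "Re z > 0 \<Longrightarrow> z \<notin> \<int>\<^sub>\<le>\<^sub>0"
  by (auto elim!: nonpos_Ints_cases)

lemma pochhammer_growth:
  fixes z :: complex
  obtains C where "C > 0"
    "\<And>n. n > 0 \<Longrightarrow> norm (pochhammer z (Suc n)) \<le> C * fact n * real n powr Re z"
proof -
  have "Bseq (rGamma_series z)"
    by (rule convergent_imp_Bseq) (auto intro: convergentI rGamma_series_LIMSEQ)
  then obtain C where C: "C > 0" "\<And>n. norm (rGamma_series z n) \<le> C"
    by (auto elim: BseqE)
  have "norm (pochhammer z (Suc n)) \<le> C * fact n * real n powr Re z" if "n > 0" for n
    using C(2)[of n] that
    by (simp add: rGamma_series_def norm_divide norm_mult powr_def field_simps)
  with C(1) show ?thesis by (rule that)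
qed

text \<open>For \<open>Re z > 0\<close> the quantity is the quotient of \<open>rGamma z\<close> by \<open>rGamma_series z n\<close>, and the latter
  tends to \<open>rGamma z \<noteq> 0\<close>.  At the poles of \<open>\<Gamma>\<close> that quotient is \<open>0 / 0\<close>, so the remaining \<open>z\<close>
  are reached by the recurrence from \<open>z + 1\<close> to \<open>z\<close>.\<close>

lemma rGamma_shift_asymptotics:
  fixes z :: complex
  shows "(\<lambda>n. rGamma (z + of_nat (Suc n)) * fact n * of_nat n powr z) \<longlonglongrightarrow> 1"
proof -
  have *: "(\<lambda>n. rGamma (z + of_nat (Suc n)) * fact n * of_nat n powr z) \<longlonglongrightarrow> 1"
    if "Re z > - real N" for N z
    using that
  proof (induction N arbitrary: z)
    case 0
    hence z: "z \<notin> \<int>\<^sub>\<le>\<^sub>0" by (intro not_nonpos_Int_if_Re_pos) auto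
    hence nz: "rGamma z \<noteq> 0" by (simp add: rGamma_eq_zero_iff)
    have "(\<lambda>n. rGamma z / rGamma_series z n) \<longlonglongrightarrow> rGamma z / rGamma z"
      by (intro tendsto_intros nz)
    moreover have "eventually (\<lambda>n. rGamma z / rGamma_series z n
                     = rGamma (z + of_nat (Suc n)) * fact n * of_nat n powr z) sequentially"
      using eventually_gt_at_top[of 0]
    proof eventually_elim
      case (elim n)
      have "pochhammer z (Suc n) \<noteq> 0"
        using z pochhammer_eq_0_imp_nonpos_Int by blast
      thus ?case using elim pochhammer_rGamma[of z "Suc n"]
        by (simp add: rGamma_series_def powr_def field_simps)
    qed
    ultimately show ?case using nz by (auto dest: Lim_transform_eventually)
  next
    case (Suc N)
    have "(\<lambda>n. rGamma (z + 1 + of_nat (Suc n)) * fact n * of_nat n powr (z + 1)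
             * ((z + 1) * inverse (of_nat n) + 1)) \<longlonglongrightarrow> 1 * ((z + 1) * 0 + 1)"
      using Suc.prems by (intro tendsto_mult tendsto_add tendsto_const Suc.IH lim_inverse_n) auto
    moreover have "eventually (\<lambda>n. rGamma (z + 1 + of_nat (Suc n)) * fact n * of_nat n powr (z + 1)
             * ((z + 1) * inverse (of_nat n) + 1)
             = rGamma (z + of_nat (Suc n)) * fact n * of_nat n powr z) sequentially"
      using eventually_gt_at_top[of 0]
    proof eventually_elim
      case (elim n)
      have "(z + 1 + of_nat n) * rGamma (z + 1 + of_nat (Suc n)) = rGamma (z + of_nat (Suc n))"
        using rGamma_plus1[of "z + 1 + of_nat n"] by (simp add: algebra_simps)
      moreover have "of_nat n powr (z + 1) = of_nat n powr z * of_nat n"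
        using elim by (simp add: powr_add)
      ultimately show ?case using elim by (simp add: field_simps flip: distrib_left)
    qed
    ultimately have "(\<lambda>n. rGamma (z + of_nat (Suc n)) * fact n * of_nat n powr z)
        \<longlonglongrightarrow> 1 * ((z + 1) * 0 + 1)"
      by (rule Lim_transform_eventually)
    thus ?case by simp
  qed
  obtain N where "- Re z < real N" using reals_Archimedean2 by blast
  thus ?thesis by (intro *[of N]) auto
qed

text \<open>A term of \<open>\<^sub>2F\<^sub>1(a,b;c;1) / \<Gamma>(c)\<close>, an entire function of \<open>c\<close>.\<close>

definition gauss_term :: "complex \<Rightarrow> complex \<Rightarrow> complex \<Rightarrow> nat \<Rightarrow> complex" where
  "gauss_term a b c n = pochhammer a n * pochhammer b n / fact n * rGamma (c + of_nat n)"

lemma gauss_term_bound: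
  obtains C where "\<And>n. n > 0 \<Longrightarrow> norm (gauss_term a b c (Suc n)) \<le> C * real n powr (Re (a + b - c) - 1)"
proof -
  obtain A where A: "A > 0" "\<And>n. n > 0 \<Longrightarrow> norm (pochhammer a (Suc n)) \<le> A * fact n * real n powr Re a"
    using pochhammer_growth by blast
  obtain B where B: "B > 0" "\<And>n. n > 0 \<Longrightarrow> norm (pochhammer b (Suc n)) \<le> B * fact n * real n powr Re b"
    using pochhammer_growth by blast
  have "Bseq (\<lambda>n. rGamma (c + of_nat (Suc n)) * fact n * of_nat n powr c)"
    by (rule convergent_imp_Bseq) (auto intro: convergentI rGamma_shift_asymptotics simp del: of_nat_Suc)
  then obtain C where C: "C > 0" "\<And>n. norm (rGamma (c + of_nat (Suc n)) * fact n * of_nat n powr c) \<le> C"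
    by (auto elim: BseqE)
  have "norm (gauss_term a b c (Suc n)) \<le> A * B * C * real n powr (Re (a + b - c) - 1)" if n: "n > 0" for n
  proof -
    have pos: "real n powr Re c > 0" using n by simp
    have "norm (rGamma (c + of_nat (Suc n))) * fact n * real n powr Re c \<le> C"
      using C(2)[of n] n by (simp add: norm_mult norm_powr_real_powr)
    hence "norm (rGamma (c + of_nat (Suc n))) \<le> C / (fact n * real n powr Re c)"
      using pos by (simp add: field_simps)
    hence "norm (gauss_term a b c (Suc n))
        \<le> (A * fact n * real n powr Re a) * (B * fact n * real n powr Re b) / fact (Suc n)
           * (C / (fact n * real n powr Re c))"
      unfolding gauss_term_def norm_mult norm_divide norm_fact
      by (intro mult_mono divide_right_mono A B n)
         (use A(1) B(1) n in auto)
    also have "\<dots> = A * B * C * (real n powr (Re (a + b - c))) / (1 + real n)"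
    proof -
      have "(fact (Suc n) :: real) = (1 + real n) * fact n" by simp
      thus ?thesis using pos by (simp add: powr_add powr_diff divide_simps del: fact_Suc)
    qed
    also have "\<dots> \<le> A * B * C * (real n powr (Re (a + b - c))) / real n"
      using A(1) B(1) C(1) n by (intro divide_left_mono) auto
    also have "\<dots> = A * B * C * real n powr (Re (a + b - c) - 1)"
      using n by (simp add: powr_diff)
    finally show ?thesis .
  qed
  thus ?thesis by (rule that)
qed

lemma summable_norm_gauss_term:
  assumes "Re (c - a - b) > 0"
  shows "summable (\<lambda>n. norm (gauss_term a b c n))"
proof -
  obtain C where C: "\<And>n. n > 0 \<Longrightarrow> norm (gauss_term a b c (Suc n)) \<le> C * real n powr (Re (a + b - c) - 1)"
    using gauss_term_bound by blast
  have "summable (\<lambda>n. C * real n powr (Re (a + b - c) - 1))"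
    using assms by (intro summable_mult) (simp add: summable_real_powr_iff)
  hence "summable (\<lambda>n. norm (gauss_term a b c (Suc n)))"
    using C by (elim summable_comparison_test_ev[rotated])
       (auto intro!: eventually_mono[OF eventually_gt_at_top[of 0]])
  thus ?thesis by (subst summable_Suc_iff [symmetric])
qed

lemma gauss_term_times_n_tendsto_0:
  assumes "Re (c - a - b) > 0"
  shows "(\<lambda>n. of_nat n * gauss_term a b c n) \<longlonglongrightarrow> 0"
proof -
  obtain C where C: "\<And>n. n > 0 \<Longrightarrow> norm (gauss_term a b c (Suc n)) \<le> C * real n powr (Re (a + b - c) - 1)"
    using gauss_term_bound by blast
  have "(\<lambda>n. of_nat (Suc n) * gauss_term a b c (Suc n)) \<longlonglongrightarrow> 0"
  proof (rule Lim_null_comparison)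
    show "eventually (\<lambda>n. norm (of_nat (Suc n) * gauss_term a b c (Suc n))
        \<le> 2 * C * real n powr (Re (a + b - c))) sequentially"
      using eventually_gt_at_top[of 0]
    proof eventually_elim
      case (elim n)
      have "norm (of_nat (Suc n) * gauss_term a b c (Suc n))
         \<le> (2 * real n) * (C * real n powr (Re (a + b - c) - 1))"
        unfolding norm_mult norm_of_nat by (intro mult_mono C elim) (use elim in auto)
      also have "\<dots> = 2 * C * real n powr (Re (a + b - c))"
        using elim by (simp add: powr_diff)
      finally show ?case .
    qed
    have "(\<lambda>n. real n powr (Re (a + b - c))) \<longlonglongrightarrow> 0"
      using assms by (intro tendsto_neg_powr filterlim_real_sequentially) auto
    thus "(\<lambda>n. 2 * C * real n powr (Re (a + b - c))) \<longlonglongrightarrow> 0"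
      by (intro tendsto_mult_right_zero)
  qed
  thus ?thesis by (rule LIMSEQ_imp_Suc)
qed

text \<open>The difference of the two sides telescopes: it is the sum of \<open>u n - u (Suc n)\<close> for
  \<open>u n = n * gauss_term a b c n\<close>, and \<open>u\<close> vanishes at 0 and at infinity.\<close>

lemma gauss_sum_contiguous:
  assumes "Re (c - a - b) > 0"
  shows "(c - a - b) * (\<Sum>n. gauss_term a b c n) = (c - a) * (c - b) * (\<Sum>n. gauss_term a b (c + 1) n)"
proof -
  define u where "u n = of_nat n * gauss_term a b c n" for n
  have step: "u n - u (Suc n) = (c - a - b) * gauss_term a b c n - (c - a) * (c - b) * gauss_term a b (c + 1) n" for n
  proof -
    have g: "gauss_term a b c n = (c + of_nat n) * gauss_term a b (c + 1) n"
      using rGamma_plus1[of "c + of_nat n"] by (simp add: gauss_term_def algebra_simps)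
    have "u (Suc n) = (a + of_nat n) * (b + of_nat n) * gauss_term a b (c + 1) n"
    proof -
      have "c + 1 + of_nat n = c + of_nat (Suc n)" by simp
      moreover have "(fact (Suc n) :: complex) = of_nat (Suc n) * fact n" by simp
      ultimately show ?thesis
        unfolding u_def gauss_term_def pochhammer_Suc
        by (simp only:) (simp add: divide_simps del: of_nat_Suc fact_Suc)
    qed
    thus ?thesis unfolding g u_def by (simp add: algebra_simps)
  qed
  have "(\<lambda>n. u n - u (Suc n)) sums (u 0 - 0)"
    by (rule telescope_sums') (unfold u_def, rule gauss_term_times_n_tendsto_0[OF assms])
  hence "(\<lambda>n. (c - a - b) * gauss_term a b c n - (c - a) * (c - b) * gauss_term a b (c + 1) n) sums 0"
    by (simp add: step) (simp add: u_def)
  moreover have "(\<lambda>n. (c - a - b) * gauss_term a b c n - (c - a) * (c - b) * gauss_term a b (c + 1) n) sums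
     ((c - a - b) * (\<Sum>n. gauss_term a b c n) - (c - a) * (c - b) * (\<Sum>n. gauss_term a b (c + 1) n))"
    using assms by (intro sums_diff sums_mult summable_sums summable_norm_cancel[OF summable_norm_gauss_term]) auto
  ultimately show ?thesis by (auto dest: sums_unique2)
qed

lemma gauss_sum_shift:
  assumes "Re (c - a - b) > 0"
  shows "pochhammer (c - a - b) N * (\<Sum>n. gauss_term a b c n)
       = pochhammer (c - a) N * pochhammer (c - b) N * (\<Sum>n. gauss_term a b (c + of_nat N) n)"
proof (induction N)
  case (Suc N)
  have Re_pos: "Re (c + of_nat N - a - b) > 0" using assms by simp
  have IH2: "(c - a - b + of_nat N) * (\<Sum>n. gauss_term a b (c + of_nat N) n)
      = (c - a + of_nat N) * (c - b + of_nat N) * (\<Sum>n. gauss_term a b (c + of_nat (Suc N)) n)"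
  proof -
    have "c + of_nat N - a = c - a + of_nat N" "c + of_nat N - b = c - b + of_nat N"
      "c - a + of_nat N - b = c - a - b + of_nat N" "c + of_nat N + 1 = c + of_nat (Suc N)"
      by simp_all
    with gauss_sum_contiguous[OF Re_pos] show ?thesis by (simp only:)
  qed
  have "pochhammer (c - a - b) (Suc N) * (\<Sum>n. gauss_term a b c n)
      = (c - a - b + of_nat N) * (pochhammer (c - a - b) N * (\<Sum>n. gauss_term a b c n))"
    by (simp add: pochhammer_Suc)
  also have "\<dots> = pochhammer (c - a) N * pochhammer (c - b) N
      * ((c - a - b + of_nat N) * (\<Sum>n. gauss_term a b (c + of_nat N) n))"
    by (subst Suc.IH) simp
  also have "\<dots> = pochhammer (c - a) (Suc N) * pochhammer (c - b) (Suc N)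
      * (\<Sum>n. gauss_term a b (c + of_nat (Suc N)) n)"
    unfolding IH2 by (simp add: pochhammer_Suc)
  finally show ?case .
qed simp

text \<open>As \<open>c\<close> moves to the right, all terms of the hypergeometric series but the first tend to 0,
  dominated by the series with lower parameter \<open>r\<close>; hence the regularised sum behaves like
  \<open>rGamma\<close> itself.\<close>

lemma gauss_sum_asymptotics:
  "(\<lambda>N. (\<Sum>n. gauss_term a b (c + of_nat (Suc N)) n) * fact N * of_nat N powr c) \<longlonglongrightarrow> 1"
proof -
  obtain N0 where N0: "\<bar>Re (a + b)\<bar> + \<bar>Re c\<bar> < real N0" using reals_Archimedean2 by blast
  \<comment> \<open>The lower parameter of the majorant: positive, and large enough for convergence.\<close>
  define r where "r = Re c + real N0"
  have r: "r > 0" "r > Re (a + b)" using N0 by (auto simp: r_def)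
  define h where "h n = norm (pochhammer a n * pochhammer b n / fact n) / pochhammer r n" for n
  define f where "f n N = pochhammer a n * pochhammer b n / fact n / pochhammer (c + of_nat (Suc N)) n" for n N
  have poch: "norm (pochhammer (c + of_nat (Suc N)) n) \<ge> pochhammer r n" if "N \<ge> N0" for N n
    unfolding pochhammer_prod prod_norm[symmetric]
    by (intro prod_mono) (use r that in \<open>auto simp: r_def intro!: order.trans[OF _ complex_Re_le_cmod]\<close>)
  have ev: "eventually (\<lambda>N. \<forall>n. f n N * rGamma (c + of_nat (Suc N)) = gauss_term a b (c + of_nat (Suc N)) n) sequentially"
    using eventually_ge_at_top[of N0]
  proof eventually_elim
    case (elim N)
    have nz: "pochhammer (c + of_nat (Suc N)) n \<noteq> 0" for n
      using poch[OF elim, of n] pochhammer_pos[OF r(1), of n] by auto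
    show ?case
    proof
      fix n
      show "f n N * rGamma (c + of_nat (Suc N)) = gauss_term a b (c + of_nat (Suc N)) n"
        using nz[of n] by (subst pochhammer_rGamma[of _ n]) (simp add: f_def gauss_term_def)
    qed
  qed
  have h: "summable h"
  proof -
    have "summable (\<lambda>n. norm (Gamma (of_real r) :: complex) * norm (gauss_term a b (of_real r) n))"
      using r by (intro summable_mult summable_norm_gauss_term) auto
    also have "(\<lambda>n. norm (Gamma (of_real r) :: complex) * norm (gauss_term a b (of_real r) n)) = h"
    proof
      fix n
      have *: "of_real r \<notin> (\<int>\<^sub>\<le>\<^sub>0 :: complex set)" using r(1) by (intro not_nonpos_Int_if_Re_pos) auto
      have "Gamma (of_real r) * rGamma (of_real r + of_nat n) = 1 / (pochhammer (of_real r) n :: complex)"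
      proof -
        have "Gamma (of_real r) * rGamma (of_real r :: complex) = 1"
          using * by (simp add: Gamma_def rGamma_eq_zero_iff)
        moreover have "pochhammer (of_real r) n \<noteq> (0 :: complex)"
          using pochhammer_pos[OF r(1), of n] by (simp add: pochhammer_of_real)
        ultimately show ?thesis using pochhammer_rGamma[of "of_real r :: complex" n]
          by (simp add: divide_simps mult_ac)
      qed
      hence "Gamma (of_real r) * gauss_term a b (of_real r) n
          = pochhammer a n * pochhammer b n / fact n / of_real (pochhammer r n)"
        by (simp add: gauss_term_def pochhammer_of_real mult_ac)
      hence "norm (Gamma (of_real r) * gauss_term a b (of_real r) n)
          = norm (pochhammer a n * pochhammer b n / fact n) / norm (of_real (pochhammer r n) :: complex)"
        by (simp add: norm_divide norm_mult)
      thus "norm (Gamma (of_real r) :: complex) * norm (gauss_term a b (of_real r) n) = h n"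
        using pochhammer_pos[OF r(1), of n] by (simp add: h_def norm_mult)
    qed
    finally show ?thesis .
  qed
  have lim: "(\<lambda>N. f n N) \<longlonglongrightarrow> (if n = 0 then 1 else 0)" for n
  proof (cases n)
    case 0
    thus ?thesis by (simp add: f_def)
  next
    case (Suc k)
    define D where "D = norm (pochhammer a n * pochhammer b n / fact n) / pochhammer r k"
    have "(\<lambda>N. f n N) \<longlonglongrightarrow> 0"
    proof (rule Lim_null_comparison)
      show "eventually (\<lambda>N. norm (f n N) \<le> D * inverse (norm (c + of_nat (Suc N)))) sequentially"
        using eventually_ge_at_top[of N0]
      proof eventually_elim
        case (elim N)
        have p: "pochhammer r k > 0" by (rule pochhammer_pos[OF r(1)])
        have "pochhammer r k \<le> norm (pochhammer (c + of_nat (Suc (Suc N))) k)"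
          using poch[of "Suc N" k] elim by simp
        hence "inverse (norm (pochhammer (c + of_nat (Suc (Suc N))) k)) \<le> inverse (pochhammer r k)"
          using p by (intro le_imp_inverse_le)
        hence "norm (pochhammer a n * pochhammer b n / fact n) * inverse (norm (c + of_nat (Suc N)))
             * inverse (norm (pochhammer (c + of_nat (Suc (Suc N))) k))
          \<le> norm (pochhammer a n * pochhammer b n / fact n) * inverse (norm (c + of_nat (Suc N)))
             * inverse (pochhammer r k)"
          by (intro mult_left_mono) auto
        moreover have "pochhammer (c + of_nat (Suc N)) n
            = (c + of_nat (Suc N)) * pochhammer (c + of_nat (Suc (Suc N))) k"
          unfolding Suc by (subst pochhammer_rec) (simp add: add_ac)
        ultimately show ?case
          by (simp add: f_def D_def norm_mult norm_divide divide_simps mult_ac)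
      qed
      have "filterlim (\<lambda>N. norm (c + of_nat (Suc N))) at_top sequentially"
      proof (rule filterlim_at_top_mono)
        show "filterlim (\<lambda>N. Re c + 1 + real N) at_top sequentially"
          by (intro filterlim_tendsto_add_at_top[OF tendsto_const] filterlim_real_sequentially)
        show "eventually (\<lambda>N. Re c + 1 + real N \<le> norm (c + of_nat (Suc N))) sequentially"
          by (intro always_eventually allI order.trans[OF _ complex_Re_le_cmod]) auto
      qed
      hence "(\<lambda>N. inverse (norm (c + of_nat (Suc N)))) \<longlonglongrightarrow> 0"
        by (rule tendsto_inverse_0_at_top)
      thus "(\<lambda>N. D * inverse (norm (c + of_nat (Suc N)))) \<longlonglongrightarrow> 0"
        by (rule tendsto_mult_right_zero)
    qed
    thus ?thesis using Suc by simp
  qed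
  have bound: "eventually (\<lambda>(n,N). norm (f n N) \<le> h n) (at_top \<times>\<^sub>F sequentially)"
  proof -
    have "norm (f n N) \<le> h n" if "N \<ge> N0" for n N
      using poch[OF that, of n] pochhammer_pos[OF r(1), of n]
      by (auto simp: f_def h_def norm_divide norm_mult intro!: divide_left_mono mult_pos_pos)
    thus ?thesis
      unfolding eventually_prod_filter
      by (intro exI[of _ "\<lambda>_. True"] exI[of _ "\<lambda>N. N \<ge> N0"]) auto
  qed
  have "(\<lambda>N. \<Sum>n. f n N) \<longlonglongrightarrow> (\<Sum>n. if n = 0 then 1 else 0)"
    using tannerys_theorem[OF lim bound h] by simp
  hence "(\<lambda>N. \<Sum>n. f n N) \<longlonglongrightarrow> 1"
    using sums_unique[OF sums_single[of 0 "\<lambda>_. 1 :: complex"]] by simp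
  hence "(\<lambda>N. (\<Sum>n. f n N) * (rGamma (c + of_nat (Suc N)) * fact N * of_nat N powr c)) \<longlonglongrightarrow> 1 * 1"
    by (intro tendsto_mult rGamma_shift_asymptotics)
  moreover have "eventually (\<lambda>N. (\<Sum>n. f n N) * (rGamma (c + of_nat (Suc N)) * fact N * of_nat N powr c)
     = (\<Sum>n. gauss_term a b (c + of_nat (Suc N)) n) * fact N * of_nat N powr c) sequentially"
    using ev eventually_ge_at_top[of N0]
  proof eventually_elim
    case (elim N)
    have "norm (f n N) \<le> h n" for n
      using poch[OF elim(2), of n] pochhammer_pos[OF r(1), of n]
      by (auto simp: f_def h_def norm_divide norm_mult intro!: divide_left_mono mult_pos_pos)
    hence "summable (\<lambda>n. f n N)" by (intro summable_comparison_test'[OF h]) auto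
    hence "(\<Sum>n. f n N) * rGamma (c + of_nat (Suc N)) = (\<Sum>n. f n N * rGamma (c + of_nat (Suc N)))"
      by (simp add: suminf_mult2)
    thus ?case using elim(1) by (simp add: mult.assoc[symmetric])
  qed
  ultimately have "(\<lambda>N. (\<Sum>n. gauss_term a b (c + of_nat (Suc N)) n) * fact N * of_nat N powr c) \<longlonglongrightarrow> 1 * 1"
    by (rule Lim_transform_eventually)
  thus ?thesis by simp
qed

text \<open>Gauss's theorem: the contiguous relation multiplies out to a quotient of Pochhammer symbols, which
  after normalisation are the approximants \<open>rGamma_series\<close> of the three Gamma factors.\<close>

theorem gauss_sum:
  assumes "Re (c - a - b) > 0"
  shows "gauss_term a b c sums (Gamma (c - a - b) * rGamma (c - a) * rGamma (c - b))"
proof -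
  define G where "G = (\<Sum>n. gauss_term a b c n)"
  define H where "H N = (\<Sum>n. gauss_term a b (c + of_nat (Suc N)) n)" for N
  have "c - a - b \<notin> \<int>\<^sub>\<le>\<^sub>0" using assms by (rule not_nonpos_Int_if_Re_pos)
  hence nz: "rGamma (c - a - b) \<noteq> 0" by (simp add: rGamma_eq_zero_iff)
  have "(\<lambda>N. rGamma_series (c - a) N * rGamma_series (c - b) N * (H N * fact N * of_nat N powr c))
     \<longlonglongrightarrow> rGamma (c - a) * rGamma (c - b) * 1"
    unfolding H_def by (intro tendsto_mult rGamma_series_LIMSEQ gauss_sum_asymptotics)
  moreover have "eventually (\<lambda>N. rGamma_series (c - a) N * rGamma_series (c - b) N * (H N * fact N * of_nat N powr c)
     = rGamma_series (c - a - b) N * G) sequentially"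
    using eventually_gt_at_top[of 0]
  proof eventually_elim
    case (elim N)
    have "(of_nat N :: complex) powr c = exp (c * of_real (ln (of_nat N)))"
      using elim by (simp add: powr_def)
    moreover have "pochhammer (c - a - b) (Suc N) * G = pochhammer (c - a) (Suc N) * pochhammer (c - b) (Suc N) * H N"
      unfolding G_def H_def by (rule gauss_sum_shift[OF assms])
    moreover have "exp (c * z) * exp ((c - a - b) * z) = exp ((c - a) * z) * exp ((c - b) * z)" for z
      by (simp add: algebra_simps flip: exp_add)
    ultimately show ?case
      by (simp add: rGamma_series_def divide_simps)
  qed
  ultimately have "(\<lambda>N. rGamma_series (c - a - b) N * G) \<longlonglongrightarrow> rGamma (c - a) * rGamma (c - b)"
    by (auto dest: Lim_transform_eventually)
  moreover have "(\<lambda>N. rGamma_series (c - a - b) N * G) \<longlonglongrightarrow> rGamma (c - a - b) * G"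
    by (intro tendsto_intros)
  ultimately have "rGamma (c - a - b) * G = rGamma (c - a) * rGamma (c - b)"
    by (rule LIMSEQ_unique[rotated])
  hence "G = Gamma (c - a - b) * rGamma (c - a) * rGamma (c - b)"
    using nz by (simp add: Gamma_def field_simps)
  moreover have "gauss_term a b c sums G"
    unfolding G_def using summable_norm_cancel[OF summable_norm_gauss_term[OF assms]] by (rule summable_sums)
  ultimately show ?thesis by simp
qed

section \<open>Termwise integration and Beta integrals\<close>

text \<open>Termwise integration under \<open>\<Sum> \<integral>\<bar>f\<^sub>i\<bar> < \<infinity>\<close>.  The pointwise absolute convergence is a conclusion, valid almost
  everywhere; this spares any pointwise estimate of Gauss functions that is uniform in their
  parameters.\<close>

lemma suminf_integral_L1:
  fixes f :: "nat \<Rightarrow> 'a \<Rightarrow> complex"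
  assumes f: "\<And>i. integrable M (f i)"
    and B: "\<And>i. (\<integral>t. norm (f i t) \<partial>M) \<le> B i" "summable B"
  shows "AE t in M. summable (\<lambda>i. norm (f i t))"
    and "integrable M (\<lambda>t. \<Sum>i. f i t)"
    and "(\<lambda>i. integral\<^sup>L M (f i)) sums (\<integral>t. (\<Sum>i. f i t) \<partial>M)"
    and "(\<integral>t. norm (\<Sum>i. f i t) \<partial>M) \<le> (\<Sum>i. B i)"
proof -
  have pos: "(\<integral>t. norm (f i t) \<partial>M) \<ge> 0" for i by simp
  have s: "summable (\<lambda>i. \<integral>t. norm (f i t) \<partial>M)"
    by (rule summable_comparison_test'[OF B(2), of 0]) (use B(1) in auto)
  have meas: "f i \<in> borel_measurable M" for i using f[of i] by simp
  note [measurable] = meas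
  have "(\<integral>\<^sup>+ t. (\<Sum>i. ennreal (norm (f i t))) \<partial>M) = (\<Sum>i. \<integral>\<^sup>+ t. ennreal (norm (f i t)) \<partial>M)"
    by (rule nn_integral_suminf) measurable
  also have "\<dots> = (\<Sum>i. ennreal (\<integral>t. norm (f i t) \<partial>M))"
    by (intro suminf_cong nn_integral_eq_integral integrable_norm f) auto
  also have "\<dots> < top"
    using ennreal_suminf_neq_top[OF s pos] by (simp add: less_top)
  finally have "(\<integral>\<^sup>+ t. (\<Sum>i. ennreal (norm (f i t))) \<partial>M) \<noteq> \<infinity>"
    by simp
  hence "AE t in M. (\<Sum>i. ennreal (norm (f i t))) \<noteq> \<infinity>"
    by (intro nn_integral_noteq_infinite) auto
  thus ae: "AE t in M. summable (\<lambda>i. norm (f i t))"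
    by eventually_elim (rule summable_suminf_not_top, auto)
  show "integrable M (\<lambda>t. \<Sum>i. f i t)" by (rule integrable_suminf[OF f ae s])
  show "(\<lambda>i. integral\<^sup>L M (f i)) sums (\<integral>t. (\<Sum>i. f i t) \<partial>M)" by (rule sums_integral[OF f ae s])
  have ae': "AE t in M. summable (\<lambda>i. norm (norm (f i t)))" using ae by simp
  have s': "summable (\<lambda>i. \<integral>t. norm (norm (f i t)) \<partial>M)" using s by simp
  have "(\<integral>t. norm (\<Sum>i. f i t) \<partial>M) \<le> (\<integral>t. (\<Sum>i. norm (f i t)) \<partial>M)"
  proof (rule integral_mono_AE)
    show "integrable M (\<lambda>t. norm (\<Sum>i. f i t))"
      by (intro integrable_norm integrable_suminf[OF f ae s])
    show "integrable M (\<lambda>t. \<Sum>i. norm (f i t))"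
      by (intro integrable_suminf[OF integrable_norm[OF f] ae' s'])
    show "AE t in M. norm (\<Sum>i. f i t) \<le> (\<Sum>i. norm (f i t))"
      using ae by eventually_elim (rule summable_norm)
  qed
  also have "\<dots> = (\<Sum>i. \<integral>t. norm (f i t) \<partial>M)"
    by (rule integral_suminf[OF integrable_norm[OF f] ae' s'])
  also have "\<dots> \<le> (\<Sum>i. B i)" by (intro suminf_le B s)
  finally show "(\<integral>t. norm (\<Sum>i. f i t) \<partial>M) \<le> (\<Sum>i. B i)" .
qed

text \<open>Expand \<open>(1 - \<phi>) powr (c - 1)\<close> by the binomial series.  The moments turn the sum into
  \<open>\<Sum>n. (1 - c)\<^sub>n / (n! (d + n))\<close>, which is a Gauss sum with parameters \<open>1 - c\<close>, \<open>d\<close>, \<open>d + 1\<close>.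
  Stating this for an arbitrary measure gives the Beta integral on the unit interval
  (\<open>\<phi> t = t\<close>) and on a half-line (\<open>\<phi> t = x / t\<close>) without a change of variables.\<close>

lemma beta_integral_from_moments:
  fixes g :: "'a \<Rightarrow> complex" and \<phi> :: "'a \<Rightarrow> real" and c d :: complex
  assumes c: "Re c > 0" and d: "Re d > 0"
    and \<phi>: "\<And>t. t \<in> space M \<Longrightarrow> \<bar>\<phi> t\<bar> < 1"
    and moment: "\<And>n. integrable M (\<lambda>t. of_real (\<phi> t) ^ n * g t)"
      "\<And>n. (\<integral>t. of_real (\<phi> t) ^ n * g t \<partial>M) = 1 / (d + of_nat n)"
      "\<And>n. (\<integral>t. norm (of_real (\<phi> t) ^ n * g t) \<partial>M) = 1 / (Re d + real n)"
  shows "integrable M (\<lambda>t. of_real (1 - \<phi> t) powr (c - 1) * g t)"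
    and "(\<integral>t. of_real (1 - \<phi> t) powr (c - 1) * g t \<partial>M) = Gamma c * Gamma d * rGamma (c + d)"
proof -
  define f where "f n t = pochhammer (1 - c) n / fact n * (of_real (\<phi> t) ^ n * g t)" for n t
  have term_eq: "Gamma d * gauss_term (1 - c) d (d + 1) n = pochhammer (1 - c) n / fact n * (1 / (d + of_nat n))"
    if d: "Re d > 0" for d n
  proof -
    have nz: "rGamma d \<noteq> 0" "d + of_nat n \<noteq> 0"
      using not_nonpos_Int_if_Re_pos[OF d] not_nonpos_Int_if_Re_pos[of "d + of_nat n"] d
      by (auto simp: rGamma_eq_zero_iff)
    have "rGamma d = pochhammer d n * ((d + of_nat n) * rGamma (d + 1 + of_nat n))"
      using pochhammer_rGamma[of d n] rGamma_plus1[of "d + of_nat n"] by (simp add: add_ac)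
    hence "pochhammer d n * rGamma (d + 1 + of_nat n) = rGamma d / (d + of_nat n)"
      using nz by (simp add: field_simps)
    moreover have "gauss_term (1 - c) d (d + 1) n
        = pochhammer (1 - c) n / fact n * (pochhammer d n * rGamma (d + 1 + of_nat n))"
      by (simp add: gauss_term_def)
    ultimately have "gauss_term (1 - c) d (d + 1) n = pochhammer (1 - c) n / fact n * (rGamma d / (d + of_nat n))"
      by (simp only:)
    thus ?thesis using nz by (simp add: Gamma_def)
  qed
  have f_int: "integrable M (f n)" for n
    unfolding f_def using moment(1)[of n] by simp
  have f_val: "integral\<^sup>L M (f n) = Gamma d * gauss_term (1 - c) d (d + 1) n" for n
    unfolding f_def term_eq[OF d] by (subst integral_mult_right_zero) (simp only: moment(2))
  have f_norm: "(\<integral>t. norm (f n t) \<partial>M) \<le> norm (Gamma (of_real (Re d)) * gauss_term (1 - c) (of_real (Re d)) (of_real (Re d) + 1) n)" for n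
  proof -
    define r where "r = (of_real (Re d) :: complex)"
    have "(\<integral>t. norm (f n t) \<partial>M) = norm (pochhammer (1 - c) n / fact n) * (1 / (Re d + real n))"
      unfolding f_def norm_mult[of "pochhammer (1 - c) n / fact n"]
      by (subst integral_mult_right_zero) (simp only: moment(3))
    also have "1 / (Re d + real n) = norm (1 / (r + of_nat n))"
    proof -
      have "r + of_nat n = of_real (Re d + real n)" by (simp add: r_def)
      thus ?thesis using d by (simp only: norm_divide norm_of_real) auto
    qed
    also have "norm (pochhammer (1 - c) n / fact n) * norm (1 / (r + of_nat n))
        = norm (Gamma r * gauss_term (1 - c) r (r + 1) n)"
    proof -
      have "Re r > 0" using d by (simp add: r_def)
      from term_eq[OF this] show ?thesis by (simp only: norm_mult)
    qed
    finally show ?thesis unfolding r_def by (rule eq_refl)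
  qed
  have "summable (\<lambda>n. norm (Gamma (of_real (Re d)) * gauss_term (1 - c) (of_real (Re d)) (of_real (Re d) + 1) n))"
    unfolding norm_mult by (intro summable_mult summable_norm_gauss_term) (use c in auto)
  note L1 = suminf_integral_L1[OF f_int f_norm this]
  have sum_eq: "(\<Sum>n. f n t) = of_real (1 - \<phi> t) powr (c - 1) * g t" if "t \<in> space M" for t
  proof -
    have "(\<lambda>n. ((c - 1) gchoose n) * (- of_real (\<phi> t)) ^ n * g t) sums ((1 + (- of_real (\<phi> t))) powr (c - 1) * g t)"
      using \<phi>[OF that] by (intro sums_mult2 gen_binomial_complex) auto
    also have "(\<lambda>n. ((c - 1) gchoose n) * (- of_real (\<phi> t)) ^ n * g t) = (\<lambda>n. f n t)"
    proof
      fix n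
      have "((c - 1) gchoose n) * (- of_real (\<phi> t)) ^ n * g t = ((-1) ^ n * (-1) ^ n) * f n t"
        unfolding f_def gbinomial_pochhammer power_minus[of "of_real (\<phi> t)"] by simp
      thus "((c - 1) gchoose n) * (- of_real (\<phi> t)) ^ n * g t = f n t"
        by (simp flip: power_mult_distrib)
    qed
    finally show ?thesis by (simp add: sums_iff)
  qed
  have eq: "integrable M (\<lambda>t. \<Sum>n. f n t) = integrable M (\<lambda>t. of_real (1 - \<phi> t) powr (c - 1) * g t)"
    "(\<integral>t. (\<Sum>n. f n t) \<partial>M) = (\<integral>t. of_real (1 - \<phi> t) powr (c - 1) * g t \<partial>M)"
    by (intro Bochner_Integration.integrable_cong Bochner_Integration.integral_cong refl sum_eq; assumption)+
  show "integrable M (\<lambda>t. of_real (1 - \<phi> t) powr (c - 1) * g t)"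
    using L1(2) unfolding eq .
  have "(\<lambda>n. Gamma d * gauss_term (1 - c) d (d + 1) n) sums
     (Gamma d * (Gamma (d + 1 - (1 - c) - d) * rGamma (d + 1 - (1 - c)) * rGamma (d + 1 - d)))"
    by (intro sums_mult gauss_sum) (use c in simp)
  with L1(3) show "(\<integral>t. of_real (1 - \<phi> t) powr (c - 1) * g t \<partial>M) = Gamma c * Gamma d * rGamma (c + d)"
    unfolding f_val eq by (simp add: sums_iff mult_ac add.commute)
qed

text \<open>The moments required above, for both intervals at once: \<open>A\<close>, \<open>B\<close>, \<open>A'\<close>, \<open>B'\<close> are the boundary values of
  \<open>t powr s\<close> and of its modulus.\<close>

lemma power_integral_einterval:
  fixes a b :: ereal and s :: complex
  assumes ab: "0 \<le> a" "a < b" and s: "Re s \<noteq> 0"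
    and lim: "(((\<lambda>t. complex_of_real t powr s) \<circ> real_of_ereal) \<longlongrightarrow> A) (at_right a)"
      "(((\<lambda>t. complex_of_real t powr s) \<circ> real_of_ereal) \<longlongrightarrow> B) (at_left b)"
      "(((\<lambda>t. t powr Re s) \<circ> real_of_ereal) \<longlongrightarrow> A') (at_right a)"
      "(((\<lambda>t. t powr Re s) \<circ> real_of_ereal) \<longlongrightarrow> B') (at_left b)"
  defines "M \<equiv> restrict_space lborel (einterval a b)"
  shows "integrable M (\<lambda>t. of_real t powr (s - 1))"
    and "(\<integral>t. of_real t powr (s - 1) \<partial>M) = (B - A) / s"
    and "(\<integral>t. norm (complex_of_real t powr (s - 1)) \<partial>M) = (B' - A') / Re s"
proof -
  have s0: "s \<noteq> 0" using s by auto
  have pos: "t > 0" if "a < ereal t" for t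
    using ab(1) that by (metis ereal_less(2) le_less_trans)
  have ein: "t > 0" if "t \<in> einterval a b" for t using that pos by (auto simp: einterval_def)
  have real: "set_integrable lborel (einterval a b) (\<lambda>t. t powr (Re s - 1))"
    "(LBINT t=a..b. t powr (Re s - 1)) = B' / Re s - A' / Re s"
  proof -
    have 1: "DERIV (\<lambda>t. t powr Re s / Re s) t :> t powr (Re s - 1)" if "a < ereal t" for t
      using pos[OF that] s by (auto intro!: derivative_eq_intros simp: powr_diff)
    have 2: "isCont (\<lambda>t. t powr (Re s - 1)) t" if "a < ereal t" for t
      using pos[OF that] by (intro continuous_intros) auto
    have 3: "((((\<lambda>t. t powr Re s / Re s)) \<circ> real_of_ereal) \<longlongrightarrow> A' / Re s) (at_right a)"
      "((((\<lambda>t. t powr Re s / Re s)) \<circ> real_of_ereal) \<longlongrightarrow> B' / Re s) (at_left b)"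
      unfolding o_def by (intro tendsto_divide lim[unfolded o_def] tendsto_const s)+
    show "set_integrable lborel (einterval a b) (\<lambda>t. t powr (Re s - 1))"
      by (rule interval_integral_FTC_nonneg(1)[OF ab(2) 1 2 _ 3]) auto
    show "(LBINT t=a..b. t powr (Re s - 1)) = B' / Re s - A' / Re s"
      by (rule interval_integral_FTC_nonneg(2)[OF ab(2) 1 2 _ 3]) auto
  qed
  have norm_eq: "norm (complex_of_real t powr (s - 1)) = t powr (Re s - 1)" if "t > 0" for t
    using that by (simp add: norm_powr_real_powr)
  have sp: "space M = einterval a b" by (simp add: M_def space_restrict_space)
  have M_int: "integrable M (\<lambda>t. t powr (Re s - 1))"
    using real(1) unfolding M_def set_integrable_def by (subst integrable_restrict_space) auto
  have "(\<lambda>t. complex_of_real t powr (s - 1)) \<in> borel_measurable M"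
    unfolding M_def by (rule measurable_restrict_space1) measurable
  thus int: "integrable M (\<lambda>t. of_real t powr (s - 1))"
    by (rule Bochner_Integration.integrable_bound[OF M_int])
       (auto simp: sp norm_eq[OF ein] intro!: AE_I2)
  have cint: "set_integrable lborel (einterval a b) (\<lambda>t. complex_of_real t powr (s - 1))"
    using int unfolding M_def set_integrable_def by (subst (asm) integrable_restrict_space) auto
  have conv: "(LBINT t=a..b. h t) = integral\<^sup>L M h" for h :: "real \<Rightarrow> 'b::{banach,second_countable_topology}"
    using less_imp_le[OF ab(2)] unfolding interval_lebesgue_integral_def set_lebesgue_integral_def M_def
    by (simp add: integral_restrict_space)
  have "(LBINT t=a..b. complex_of_real t powr (s - 1)) = B / s - A / s"
  proof (rule interval_integral_FTC_integrable[OF ab(2) _ _ cint])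
    fix t assume t: "a < ereal t" "ereal t < b"
    have "((\<lambda>z. z powr s / s) has_field_derivative (complex_of_real t powr (s - 1))) (at (of_real t))"
      using pos[OF t(1)] s0 by (auto intro!: derivative_eq_intros simp: complex_nonpos_Reals_iff)
    thus "((\<lambda>t. complex_of_real t powr s / s) has_vector_derivative complex_of_real t powr (s - 1)) (at t)"
      by (rule has_vector_derivative_real_field)
    show "isCont (\<lambda>t. complex_of_real t powr (s - 1)) t"
      using pos[OF t(1)] by (intro continuous_intros) (auto simp: complex_nonpos_Reals_iff)
  next
    show "(((\<lambda>t. complex_of_real t powr s / s) \<circ> real_of_ereal) \<longlongrightarrow> A / s) (at_right a)"
      "(((\<lambda>t. complex_of_real t powr s / s) \<circ> real_of_ereal) \<longlongrightarrow> B / s) (at_left b)"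
      unfolding o_def by (intro tendsto_divide lim[unfolded o_def] tendsto_const s0)+
  qed
  thus "(\<integral>t. of_real t powr (s - 1) \<partial>M) = (B - A) / s"
    unfolding conv by (simp add: diff_divide_distrib)
  have "(\<integral>t. norm (complex_of_real t powr (s - 1)) \<partial>M) = (\<integral>t. t powr (Re s - 1) \<partial>M)"
    by (intro Bochner_Integration.integral_cong refl norm_eq ein) (simp add: sp)
  thus "(\<integral>t. norm (complex_of_real t powr (s - 1)) \<partial>M) = (B' - A') / Re s"
    using real(2) unfolding conv by (simp add: diff_divide_distrib)
qed

lemma beta_integral_01:
  fixes c d :: complex
  assumes c: "Re c > 0" and d: "Re d > 0"
  shows "integrable (restrict_space lborel {0<..<1}) (\<lambda>t. of_real t powr (c - 1) * of_real (1 - t) powr (d - 1))"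
    and "(\<integral>t. of_real t powr (c - 1) * of_real (1 - t) powr (d - 1) \<partial>restrict_space lborel {0<..<1})
         = Gamma c * Gamma d * rGamma (c + d)"
proof -
  let ?M = "restrict_space lborel {0<..<1::real}"
  have power: "integrable ?M (\<lambda>t. of_real t powr (z - 1))"
    "(\<integral>t. of_real t powr (z - 1) \<partial>?M) = (1 - 0) / z"
    "(\<integral>t. norm (complex_of_real t powr (z - 1)) \<partial>?M) = (1 - 0) / Re z" if z: "Re z > 0" for z
  proof -
    have e: "{0<..<1::real} = einterval 0 1" by (simp add: zero_ereal_def one_ereal_def)
    have 0: "(((\<lambda>t. t powr Re z) \<circ> real_of_ereal) \<longlongrightarrow> 0) (at_right 0)"
      "(((\<lambda>t. complex_of_real t powr z) \<circ> real_of_ereal) \<longlongrightarrow> 0) (at_right 0)"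
    proof -
      have "((\<lambda>t. t powr Re z) \<longlongrightarrow> 0 powr Re z) (at_right (0::real))"
        using z by (intro tendsto_powr' tendsto_intros) (auto intro!: eventually_mono[OF eventually_at_right_less])
      hence *: "((\<lambda>t. t powr Re z) \<longlongrightarrow> 0) (at_right (0::real))" by simp
      thus "(((\<lambda>t. t powr Re z) \<circ> real_of_ereal) \<longlongrightarrow> 0) (at_right 0)"
        unfolding zero_ereal_def by (simp only: ereal_tendsto_simps1)
      have "((\<lambda>t. complex_of_real t powr z) \<longlongrightarrow> 0) (at_right (0::real))"
        by (rule tendsto_norm_zero_cancel, rule Lim_transform_eventually[OF *])
           (auto simp: norm_powr_real_powr intro!: eventually_mono[OF eventually_at_right_less[of 0]])
      thus "(((\<lambda>t. complex_of_real t powr z) \<circ> real_of_ereal) \<longlongrightarrow> 0) (at_right 0)"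
        unfolding zero_ereal_def by (simp only: ereal_tendsto_simps1)
    qed
    have 1: "(((\<lambda>t. t powr Re z) \<circ> real_of_ereal) \<longlongrightarrow> 1) (at_left 1)"
      "(((\<lambda>t. complex_of_real t powr z) \<circ> real_of_ereal) \<longlongrightarrow> 1) (at_left 1)"
    proof -
      have "((\<lambda>t. t powr Re z) \<longlongrightarrow> 1 powr Re z) (at_left (1::real))"
        by (intro tendsto_powr tendsto_intros) auto
      thus "(((\<lambda>t. t powr Re z) \<circ> real_of_ereal) \<longlongrightarrow> 1) (at_left 1)"
        unfolding one_ereal_def by (simp only: ereal_tendsto_simps1 powr_one_eq_one)
      have "((\<lambda>t. complex_of_real t powr z) \<longlongrightarrow> of_real 1 powr z) (at_left (1::real))"
        by (intro tendsto_powr_complex tendsto_intros) (auto simp: complex_nonpos_Reals_iff)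
      thus "(((\<lambda>t. complex_of_real t powr z) \<circ> real_of_ereal) \<longlongrightarrow> 1) (at_left 1)"
        unfolding one_ereal_def by (simp only: ereal_tendsto_simps1 powr_one_eq_one of_real_1)
    qed
    show "integrable ?M (\<lambda>t. of_real t powr (z - 1))"
      "(\<integral>t. of_real t powr (z - 1) \<partial>?M) = (1 - 0) / z"
      "(\<integral>t. norm (complex_of_real t powr (z - 1)) \<partial>?M) = (1 - 0) / Re z"
      unfolding e
      by (rule power_integral_einterval[OF _ _ _ 0(2) 1(2) 0(1) 1(1)]; use z in simp)+
  qed
  have sp: "space ?M = {0<..<1}" by (simp add: space_restrict_space)
  have mom: "of_real t ^ n * complex_of_real t powr (c - 1) = of_real t powr (c + of_nat n - 1)"
    if "t \<in> space ?M" for t n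
    using that by (simp add: sp powr_add powr_diff field_simps)
  have cn: "Re (c + of_nat n) > 0" for n using c by (simp add: add_pos_nonneg)
  have A: "integrable ?M (\<lambda>t. of_real t ^ n * complex_of_real t powr (c - 1))" for n
    using power(1)[OF cn[of n]] by (subst Bochner_Integration.integrable_cong[OF refl mom]) auto
  have B: "(\<integral>t. of_real t ^ n * complex_of_real t powr (c - 1) \<partial>?M) = 1 / (c + of_nat n)" for n
    using power(2)[OF cn[of n]] by (subst Bochner_Integration.integral_cong[OF refl mom]) auto
  have C: "(\<integral>t. norm (of_real t ^ n * complex_of_real t powr (c - 1)) \<partial>?M) = 1 / (Re c + real n)" for n
    using power(3)[OF cn[of n]]
    by (subst Bochner_Integration.integral_cong[OF refl arg_cong[where f = norm, OF mom]]) auto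
  note * = beta_integral_from_moments[where M = ?M and \<phi> = "\<lambda>t. t" and g = "\<lambda>t. of_real t powr (c - 1)",
      OF d c _ A B C]
  show "integrable ?M (\<lambda>t. of_real t powr (c - 1) * of_real (1 - t) powr (d - 1))"
    using *(1) by (subst mult.commute) (auto simp: sp)
  show "(\<integral>t. of_real t powr (c - 1) * of_real (1 - t) powr (d - 1) \<partial>?M) = Gamma c * Gamma d * rGamma (c + d)"
    using *(2) by (subst mult.commute) (auto simp: sp add_ac mult_ac)
qed

lemma beta_integral_Ioi:
  fixes c d :: complex and x :: real
  assumes c: "Re c > 0" and d: "Re d > 0" and x: "x > 0"
  shows "integrable (restrict_space lborel {x<..}) (\<lambda>t. of_real (t - x) powr (c - 1) * of_real t powr (- c - d))"
    and "(\<integral>t. of_real (t - x) powr (c - 1) * of_real t powr (- c - d) \<partial>restrict_space lborel {x<..})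
         = of_real x powr (- d) * (Gamma c * Gamma d * rGamma (c + d))"
proof -
  let ?M = "restrict_space lborel {x<..}"
  have power: "integrable ?M (\<lambda>t. of_real t powr (- z - 1))"
    "(\<integral>t. of_real t powr (- z - 1) \<partial>?M) = of_real x powr (- z) / z"
    "(\<integral>t. norm (complex_of_real t powr (- z - 1)) \<partial>?M) = x powr (- Re z) / Re z" if z: "Re z > 0" for z
  proof -
    have e: "{x<..} = einterval (ereal x) \<infinity>" by (auto simp: einterval_def)
    have 0: "(((\<lambda>t. t powr Re (- z)) \<circ> real_of_ereal) \<longlongrightarrow> x powr Re (- z)) (at_right (ereal x))"
      "(((\<lambda>t. complex_of_real t powr (- z)) \<circ> real_of_ereal) \<longlongrightarrow> of_real x powr (- z)) (at_right (ereal x))"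
    proof -
      have "((\<lambda>t. t powr Re (- z)) \<longlongrightarrow> x powr Re (- z)) (at_right x)"
        using x by (intro tendsto_powr tendsto_intros) auto
      thus "(((\<lambda>t. t powr Re (- z)) \<circ> real_of_ereal) \<longlongrightarrow> x powr Re (- z)) (at_right (ereal x))"
        by (simp only: ereal_tendsto_simps1)
      have "((\<lambda>t. complex_of_real t powr (- z)) \<longlongrightarrow> of_real x powr (- z)) (at_right x)"
        using x by (intro tendsto_powr_complex tendsto_intros) (auto simp: complex_nonpos_Reals_iff)
      thus "(((\<lambda>t. complex_of_real t powr (- z)) \<circ> real_of_ereal) \<longlongrightarrow> of_real x powr (- z)) (at_right (ereal x))"
        by (simp only: ereal_tendsto_simps1)
    qed
    have 1: "(((\<lambda>t. t powr Re (- z)) \<circ> real_of_ereal) \<longlongrightarrow> 0) (at_left \<infinity>)"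
      "(((\<lambda>t. complex_of_real t powr (- z)) \<circ> real_of_ereal) \<longlongrightarrow> 0) (at_left \<infinity>)"
    proof -
      have "((\<lambda>t. t powr Re (- z)) \<longlongrightarrow> 0) (at_top :: real filter)"
        using z by (intro tendsto_neg_powr filterlim_ident) auto
      thus "(((\<lambda>t. t powr Re (- z)) \<circ> real_of_ereal) \<longlongrightarrow> 0) (at_left \<infinity>)"
        by (simp only: ereal_tendsto_simps1)
      have "((\<lambda>t. complex_of_real t powr (- z)) \<longlongrightarrow> 0) (at_top :: real filter)"
        using z by (intro tendsto_neg_powr_complex_of_real filterlim_ident) auto
      thus "(((\<lambda>t. complex_of_real t powr (- z)) \<circ> real_of_ereal) \<longlongrightarrow> 0) (at_left \<infinity>)"
        by (simp only: ereal_tendsto_simps1)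
    qed
    note * = power_integral_einterval[OF _ _ _ 0(2) 1(2) 0(1) 1(1)]
    show "integrable ?M (\<lambda>t. of_real t powr (- z - 1))"
      unfolding e by (rule *) (use x z in auto)
    show "(\<integral>t. of_real t powr (- z - 1) \<partial>?M) = of_real x powr (- z) / z"
      unfolding e by (subst *) (use x z in auto)
    show "(\<integral>t. norm (complex_of_real t powr (- z - 1)) \<partial>?M) = x powr (- Re z) / Re z"
      unfolding e by (subst *) (use x z in auto)
  qed
  have sp: "space ?M = {x<..}" by (simp add: space_restrict_space)
  define g where "g t = of_real x powr d * complex_of_real t powr (- d - 1)" for t
  have xp: "complex_of_real x powr (y + of_nat n) = of_real x powr y * of_real x ^ n" for y n
    using x by (simp add: powr_add)
  have mom: "of_real (x / t) ^ n * g t = of_real x powr (d + of_nat n) * of_real t powr (- (d + of_nat n) - 1)"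
    if "t \<in> space ?M" for t n
  proof -
    have "complex_of_real t powr (- (d + of_nat n) - 1) = of_real t powr (- d - 1 - of_nat n)"
      by (simp add: algebra_simps)
    also have "\<dots> = of_real t powr (- d - 1) / of_real t ^ n"
      using that x by (subst powr_diff) (simp add: sp)
    finally show ?thesis unfolding g_def xp by (simp add: power_divide)
  qed
  have dn: "Re (d + of_nat n) > 0" for n using d by (simp add: add_pos_nonneg)
  have xx: "complex_of_real x powr z * of_real x powr (- z) = 1" for z
    using x by (simp flip: powr_add)
  have A: "integrable ?M (\<lambda>t. of_real (x / t) ^ n * g t)" for n
    using power(1)[OF dn[of n]] by (subst Bochner_Integration.integrable_cong[OF refl mom]) auto
  have B: "(\<integral>t. of_real (x / t) ^ n * g t \<partial>?M) = 1 / (d + of_nat n)" for n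
  proof -
    have "(\<integral>t. of_real (x / t) ^ n * g t \<partial>?M)
        = (\<integral>t. of_real x powr (d + of_nat n) * of_real t powr (- (d + of_nat n) - 1) \<partial>?M)"
      by (intro Bochner_Integration.integral_cong refl mom)
    also have "\<dots> = (of_real x powr (d + of_nat n) * of_real x powr (- (d + of_nat n))) / (d + of_nat n)"
      unfolding integral_mult_right_zero power(2)[OF dn[of n]] by (simp only: times_divide_eq_right)
    finally show ?thesis unfolding xx .
  qed
  have C: "(\<integral>t. norm (of_real (x / t) ^ n * g t) \<partial>?M) = 1 / (Re d + real n)" for n
  proof -
    have "(\<integral>t. norm (of_real (x / t) ^ n * g t) \<partial>?M)
       = norm (of_real x powr (d + of_nat n) :: complex) * (x powr (- Re (d + of_nat n)) / Re (d + of_nat n))"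
    proof -
      have "(\<integral>t. norm (of_real (x / t) ^ n * g t) \<partial>?M)
          = (\<integral>t. norm (of_real x powr (d + of_nat n) :: complex)
                 * norm (complex_of_real t powr (- (d + of_nat n) - 1)) \<partial>?M)"
        unfolding norm_mult[symmetric]
        by (intro Bochner_Integration.integral_cong refl arg_cong[where f = norm] mom)
      thus ?thesis unfolding integral_mult_right_zero power(3)[OF dn[of n]] .
    qed
    also have "\<dots> = 1 / (Re d + real n)"
      using x by (simp add: norm_powr_real_powr flip: powr_add)
    finally show ?thesis .
  qed
  have \<phi>: "\<bar>x / t\<bar> < 1" if "t \<in> space ?M" for t using that x by (simp add: sp)
  note * = beta_integral_from_moments[OF c d \<phi> A B C]
  have eq: "of_real (t - x) powr (c - 1) * of_real t powr (- c - d)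
      = of_real x powr (- d) * (of_real (1 - x / t) powr (c - 1) * g t)" if "t \<in> space ?M" for t
  proof -
    have t: "t > x" "t > 0" using that x by (auto simp: sp)
    have "complex_of_real (t - x) = of_real t * of_real (1 - x / t)"
      using t by (simp add: field_simps flip: of_real_mult)
    also have "\<dots> powr (c - 1) = of_real t powr (c - 1) * of_real (1 - x / t) powr (c - 1)"
      using t x by (intro powr_times_real) auto
    finally have "complex_of_real (t - x) powr (c - 1) = of_real t powr (c - 1) * of_real (1 - x / t) powr (c - 1)" .
    moreover have "complex_of_real t powr (c - 1) * of_real t powr (- c - d) = of_real t powr (- d - 1)"
    proof -
      have "c - 1 + (- c - d) = - d - 1" by simp
      thus ?thesis by (simp only: powr_add [symmetric])
    qed
    ultimately have "of_real (t - x) powr (c - 1) * of_real t powr (- c - d)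
      = of_real (1 - x / t) powr (c - 1) * of_real t powr (- d - 1)"
      by (metis mult.assoc mult.commute)
    thus ?thesis using xx[of d] by (simp add: g_def mult_ac)
  qed
  show "integrable ?M (\<lambda>t. of_real (t - x) powr (c - 1) * of_real t powr (- c - d))"
    using *(1) by (subst Bochner_Integration.integrable_cong[OF refl eq]) auto
  show "(\<integral>t. of_real (t - x) powr (c - 1) * of_real t powr (- c - d) \<partial>?M)
         = of_real x powr (- d) * (Gamma c * Gamma d * rGamma (c + d))"
  proof -
    have "(\<integral>t. of_real (t - x) powr (c - 1) * of_real t powr (- c - d) \<partial>?M)
        = (\<integral>t. of_real x powr (- d) * (of_real (1 - x / t) powr (c - 1) * g t) \<partial>?M)"
      by (intro Bochner_Integration.integral_cong refl eq)
    also note integral_mult_right_zero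
    also note *(2)
    finally show ?thesis .
  qed
qed

section \<open>The Gauss function on the slit plane\<close>

abbreviation slit_plane :: "complex set" where
  "slit_plane \<equiv> - complex_of_real ` {1..}"

lemma slit_plane_iff: "z \<in> slit_plane \<longleftrightarrow> Im z \<noteq> 0 \<or> Re z < 1"
  by (auto simp: image_iff complex_eq_iff not_le)

lemma open_slit_plane: "open slit_plane"
proof -
  have "slit_plane = {z. Im z \<noteq> 0} \<union> {z. Re z < 1}" using slit_plane_iff by blast
  moreover have "open {z. Im z \<noteq> 0}"
    by (intro open_Collect_neq continuous_intros)
  ultimately show ?thesis by (auto intro: open_halfspace_Re_lt)
qed

lemma connected_slit_plane: "connected slit_plane"
proof (rule starlike_imp_connected)
  have "closed_segment 0 z \<subseteq> slit_plane" if z: "z \<in> slit_plane" for z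
  proof
    fix w assume "w \<in> closed_segment 0 z"
    then obtain u where u: "0 \<le> u" "u \<le> 1" "w = of_real u * z"
      by (auto simp: in_segment scaleR_conv_of_real)
    show "w \<in> slit_plane"
    proof (cases "u = 0 \<or> Im z \<noteq> 0")
      case False
      hence "Re z < 1" using z[unfolded slit_plane_iff] by auto
      hence "u * Re z < 1" using u False
        by (smt (verit, best) mult_le_one mult_left_le mult_less_cancel_left_pos mult_nonneg_nonpos mult_cancel_left1)
      thus ?thesis unfolding slit_plane_iff using u by simp
    qed (unfold slit_plane_iff, use u in auto)
  qed
  moreover have "0 \<in> slit_plane" unfolding slit_plane_iff by simp
  ultimately show "starlike slit_plane" unfolding starlike_def by blast
qed

lemma ball_subset_slit_plane: "ball 0 1 \<subseteq> slit_plane"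
proof
  fix z :: complex assume "z \<in> ball 0 1"
  thus "z \<in> slit_plane" unfolding slit_plane_iff using complex_Re_le_cmod[of z] by simp
qed

text \<open>Keeps Euler's integrand off the cut of the power function.\<close>

lemma one_minus_mult_slit_plane:
  assumes "z \<in> slit_plane" "0 \<le> t" "t \<le> 1"
  shows "1 - z * of_real t \<notin> \<real>\<^sub>\<le>\<^sub>0"
proof
  assume "1 - z * of_real t \<in> \<real>\<^sub>\<le>\<^sub>0"
  hence *: "Re z * t \<ge> 1" "Im z * t = 0" by (auto simp: complex_nonpos_Reals_iff)
  hence t: "t > 0" using assms(2) by (cases "t = 0") auto
  hence "Im z = 0" using * by simp
  moreover have "Re z \<ge> 1"
  proof (rule ccontr)
    assume "\<not> Re z \<ge> 1"
    hence "Re z * t < 1 * t" using t by (intro mult_strict_right_mono) auto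
    thus False using * assms by simp
  qed
  ultimately show False using assms(1)[unfolded slit_plane_iff] by auto
qed

definition gauss_coeff :: "complex \<Rightarrow> complex \<Rightarrow> complex \<Rightarrow> nat \<Rightarrow> complex" where
  "gauss_coeff a b c n = pochhammer a n * pochhammer b n / (pochhammer c n * fact n)"

definition gauss_series :: "complex \<Rightarrow> complex \<Rightarrow> complex \<Rightarrow> complex \<Rightarrow> complex" where
  "gauss_series a b c z = (\<Sum>n. gauss_coeff a b c n * z ^ n)"

lemma pochhammer_nz:
  fixes c :: complex
  assumes "Re c > 0"
  shows "pochhammer c n \<noteq> 0"
  using not_nonpos_Int_if_Re_pos[OF assms] pochhammer_eq_0_imp_nonpos_Int by blast

lemma summable_norm_gauss_coeff:
  assumes c: "Re c > 0" and z: "norm z < 1"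
  shows "summable (\<lambda>n. norm (gauss_coeff a b c n * z ^ n))"
proof -
  obtain r where r: "norm z < r" "r < 1" using dense[OF z] by blast
  have "(\<lambda>n. (a * inverse (of_nat n) + 1) * (b * inverse (of_nat n) + 1) /
             ((c * inverse (of_nat n) + 1) * (1 * inverse (of_nat n) + 1)) * z) \<longlonglongrightarrow>
        (a * 0 + 1) * (b * 0 + 1) / ((c * 0 + 1) * (1 * 0 + 1)) * z"
    by (intro tendsto_intros lim_inverse_n) auto
  hence "(\<lambda>n. norm ((a * inverse (of_nat n) + 1) * (b * inverse (of_nat n) + 1) /
             ((c * inverse (of_nat n) + 1) * (1 * inverse (of_nat n) + 1)) * z)) \<longlonglongrightarrow> norm z"
    using tendsto_norm by fastforce
  hence "eventually (\<lambda>n. norm ((a * inverse (of_nat n) + 1) * (b * inverse (of_nat n) + 1) /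
             ((c * inverse (of_nat n) + 1) * (1 * inverse (of_nat n) + 1)) * z) < r) sequentially"
    by (rule order_tendstoD(2)[OF _ r(1)])
  hence "eventually (\<lambda>n. norm (gauss_coeff a b c (Suc n) * z ^ Suc n) \<le> r * norm (gauss_coeff a b c n * z ^ n)) sequentially"
    using eventually_gt_at_top[of 0]
  proof eventually_elim
    case (elim n)
    have nz: "c + of_nat n \<noteq> 0" using c by (auto simp: complex_eq_iff)
    have "(a * inverse (of_nat n) + 1) * (b * inverse (of_nat n) + 1) /
             ((c * inverse (of_nat n) + 1) * (1 * inverse (of_nat n) + 1))
        = (a + of_nat n) * (b + of_nat n) / ((c + of_nat n) * of_nat (Suc n))"
      using elim nz by (simp add: divide_simps)
    hence "norm ((a + of_nat n) * (b + of_nat n) / ((c + of_nat n) * of_nat (Suc n)) * z) \<le> r"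
      using elim by simp
    hence "norm ((a + of_nat n) * (b + of_nat n) / ((c + of_nat n) * of_nat (Suc n)) * z)
          * norm (gauss_coeff a b c n * z ^ n) \<le> r * norm (gauss_coeff a b c n * z ^ n)"
      by (rule mult_right_mono) simp
    also have "norm ((a + of_nat n) * (b + of_nat n) / ((c + of_nat n) * of_nat (Suc n)) * z)
          * norm (gauss_coeff a b c n * z ^ n) = norm (gauss_coeff a b c (Suc n) * z ^ Suc n)"
      unfolding norm_mult[symmetric]
      by (rule arg_cong[where f = norm])
         (simp add: gauss_coeff_def pochhammer_Suc mult_ac del: of_nat_Suc)
    finally show ?case .
  qed
  then obtain N where "\<And>n. n \<ge> N \<Longrightarrow> norm (gauss_coeff a b c (Suc n) * z ^ Suc n) \<le> r * norm (gauss_coeff a b c n * z ^ n)"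
    by (auto simp: eventually_at_top_linorder)
  thus ?thesis by (intro summable_ratio_test[OF r(2)]) auto
qed

lemma gauss_series_sums:
  assumes "Re c > 0" "norm z < 1"
  shows "(\<lambda>n. gauss_coeff a b c n * z ^ n) sums gauss_series a b c z"
  unfolding gauss_series_def
  by (intro summable_sums summable_norm_cancel[OF summable_norm_gauss_coeff] assms)

text \<open>Contiguous relations have this shape on the level of coefficients.\<close>

lemma power_series_combine:
  fixes z :: complex
  assumes "(\<lambda>n. q n * z ^ n) sums G" "(\<lambda>n. r n * z ^ n) sums H"
    and "p 0 = q 0" "\<And>n. p (Suc n) = q (Suc n) + l * r n"
  shows "(\<lambda>n. p n * z ^ n) sums (G + l * z * H)"
proof -
  have "(\<lambda>n. q (Suc n) * z ^ Suc n + l * z * (r n * z ^ n)) sums (G - q 0 * z ^ 0 + l * z * H)"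
    by (intro sums_add sums_mult assms(2)) (use sums_Suc_iff[of "\<lambda>n. q n * z ^ n"] assms(1) in auto)
  also have "(\<lambda>n. q (Suc n) * z ^ Suc n + l * z * (r n * z ^ n)) = (\<lambda>n. p (Suc n) * z ^ Suc n)"
    by (simp add: assms(4) algebra_simps)
  finally show ?thesis by (subst (asm) sums_Suc_iff) (simp add: assms(3))
qed

lemma gauss_coeff_0 [simp]: "gauss_coeff a b c 0 = 1"
  by (simp add: gauss_coeff_def)

text \<open>This relation lowers \<open>c\<close> in \<open>branch_exists\<close>; the next one is its mirror image under Pfaff's
  transformation, which exchanges \<open>b\<close> and \<open>c - b\<close>.\<close>

lemma gauss_coeff_raise_c:
  assumes "Re c > 0"
  shows "gauss_coeff a b c (Suc n) = gauss_coeff a b (c + 1) (Suc n)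
           + a * b / (c * (c + 1)) * gauss_coeff (a + 1) (b + 1) (c + 2) n"
proof -
  have nz: "c \<noteq> 0" "c + 1 \<noteq> 0" "c + 1 + of_nat n \<noteq> 0" "pochhammer (c + 2) n \<noteq> 0"
    using assms pochhammer_nz[of "c + 2" n] by (auto simp: complex_eq_iff)
  have 1: "pochhammer (c + 1) (Suc n) = (c + 1) * pochhammer (c + 2) n"
    using pochhammer_rec[of "c + 1" n] by (simp add: add_ac)
  have 2: "pochhammer (c + 1) n = (c + 1) * pochhammer (c + 2) n / (c + 1 + of_nat n)"
    using 1 nz by (simp add: pochhammer_Suc divide_simps mult_ac)
  show ?thesis
    unfolding gauss_coeff_def pochhammer_rec[of a] pochhammer_rec[of b] pochhammer_rec[of c] 1 2
    using nz by (simp add: divide_simps del: of_nat_Suc) (simp add: algebra_simps)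
qed

lemma gauss_coeff_raise_bc:
  assumes "Re c > 0"
  shows "gauss_coeff a b c (Suc n) = gauss_coeff a (b + 1) (c + 1) (Suc n)
           + (- a * (c - b) / (c * (c + 1))) * gauss_coeff (a + 1) (b + 1) (c + 2) n"
proof -
  have nz: "c \<noteq> 0" "c + 1 \<noteq> 0" "c + 1 + of_nat n \<noteq> 0" "pochhammer (c + 2) n \<noteq> 0"
    using assms pochhammer_nz[of "c + 2" n] by (auto simp: complex_eq_iff)
  have 1: "pochhammer (c + 1) (Suc n) = (c + 1) * pochhammer (c + 2) n"
    using pochhammer_rec[of "c + 1" n] by (simp add: add_ac)
  have 2: "pochhammer (c + 1) n = (c + 1) * pochhammer (c + 2) n / (c + 1 + of_nat n)"
    using 1 nz by (simp add: pochhammer_Suc divide_simps mult_ac)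
  show ?thesis
    unfolding gauss_coeff_def pochhammer_rec[of a] pochhammer_rec[of b] pochhammer_rec[of c] 1 2
      pochhammer_Suc[of "b + 1"]
    using nz by (simp add: divide_simps del: of_nat_Suc) (simp add: algebra_simps)
qed

text \<open>This relation lowers \<open>b\<close>; it is its own mirror image under Pfaff's transformation.\<close>

lemma gauss_coeff_raise_b:
  assumes "Re c > 0"
  shows "gauss_coeff a b c (Suc n) = gauss_coeff a (b + 1) c (Suc n)
           + (- a / c) * gauss_coeff (a + 1) (b + 1) (c + 1) n"
proof -
  have nz: "c \<noteq> 0" "pochhammer (c + 1) n \<noteq> 0"
    using assms pochhammer_nz[of "c + 1" n] by (auto simp: complex_eq_iff)
  show ?thesis
    unfolding gauss_coeff_def pochhammer_rec[of a] pochhammer_rec[of b] pochhammer_rec[of c]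
      pochhammer_Suc[of "b + 1"]
    using nz by (simp add: divide_simps del: of_nat_Suc) (simp add: algebra_simps)
qed

lemma gauss_coeff_commute: "gauss_coeff a b c = gauss_coeff b a c"
  by (simp add: gauss_coeff_def fun_eq_iff mult_ac)

section \<open>Euler's integral\<close>

definition euler_weight :: "complex \<Rightarrow> complex \<Rightarrow> real \<Rightarrow> complex" where
  "euler_weight b c t = of_real t powr (b - 1) * of_real (1 - t) powr (c - b - 1)"

definition euler_integral :: "complex \<Rightarrow> complex \<Rightarrow> complex \<Rightarrow> complex \<Rightarrow> complex" where
  "euler_integral a b c z = Gamma c * rGamma b * rGamma (c - b) *
     (\<integral>t. euler_weight b c t * (1 - z * of_real t) powr (- a) \<partial>restrict_space lborel {0<..<1})"

text \<open>Both exponents of the weight have positive real part, so the integrand is continuous on the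
  closed interval and differentiation under the integral sign applies.\<close>

lemma euler_integral_holomorphic:
  assumes b: "Re b > 1" and cb: "Re (c - b) > 1"
  shows "euler_integral a b c holomorphic_on slit_plane"
proof -
  define f where "f z t = euler_weight b c t * (1 - z * of_real t) powr (- a)" for z and t :: real
  define f' where "f' z t = euler_weight b c t * (a * of_real t * (1 - z * of_real t) powr (- a - 1))" for z and t :: real
  have cont_w: "continuous_on {0..1} (euler_weight b c)"
    unfolding euler_weight_def by (intro continuous_intros) (use b cb in auto)
  have cont_f: "continuous_on {0..1} (f z)" if "z \<in> slit_plane" for z
    unfolding f_def
  proof (intro continuous_on_mult cont_w continuous_on_powr_complex continuous_intros)
    show "{0..1} \<subseteq> {t. Re (1 - z * of_real t) \<ge> 0 \<or> Im (1 - z * of_real t) \<noteq> 0}"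
    proof
      fix t :: real assume "t \<in> {0..1}"
      hence "1 - z * of_real t \<notin> \<real>\<^sub>\<le>\<^sub>0" using one_minus_mult_slit_plane[OF that, of t] by simp
      thus "t \<in> {t. Re (1 - z * of_real t) \<ge> 0 \<or> Im (1 - z * of_real t) \<noteq> 0}"
        unfolding complex_nonpos_Reals_iff mem_Collect_eq by linarith
    qed
    fix t :: real assume t: "t \<in> {0..1}" "1 - z * of_real t = 0"
    thus "Re (- a) > 0" using one_minus_mult_slit_plane[OF that, of t] by simp
  qed
  have int: "(\<integral>t. f z t \<partial>restrict_space lborel {0<..<1}) = integral {0..1} (f z)" if "z \<in> slit_plane" for z
  proof -
    have "set_integrable lborel {0..1} (f z)"
      by (rule borel_integrable_atLeastAtMost'[OF cont_f[OF that]])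
    hence "set_integrable lborel {0<..<1} (f z)" by (rule set_integrable_subset) auto
    from set_borel_integral_eq_integral(2)[OF this] show ?thesis
      by (simp add: set_lebesgue_integral_def integral_restrict_space integral_open_interval_real)
  qed
  have "(\<lambda>z. integral {0..1} (f z)) holomorphic_on slit_plane"
  proof -
    have "\<exists>U. open U \<and> z \<in> U \<and> (\<lambda>z. integral {0..1} (f z)) holomorphic_on U" if z: "z \<in> slit_plane" for z
    proof -
      obtain e where e: "e > 0" "ball z e \<subseteq> slit_plane"
        using open_slit_plane z open_contains_ball by blast
      have "(\<lambda>z. integral (cbox 0 1) (f z)) holomorphic_on ball z e"
      proof (rule leibniz_rule_holomorphic[where fx = f'])
        fix y t assume y: "y \<in> ball z e" and t: "t \<in> cbox 0 (1 :: real)"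
        have nz: "1 - y * of_real t \<notin> \<real>\<^sub>\<le>\<^sub>0"
          using one_minus_mult_slit_plane[of y t] y t e by auto
        have "(f' y t) = euler_weight b c t * ((- a) * (1 - y * of_real t) powr (- a - 1) * (0 - 1 * of_real t))"
          by (simp add: f'_def)
        moreover have "((\<lambda>y. f y t) has_field_derivative
           (euler_weight b c t * ((- a) * (1 - y * of_real t) powr (- a - 1) * (0 - 1 * of_real t)))) (at y)"
          unfolding f_def by (rule derivative_eq_intros refl nz | simp)+
        ultimately show "((\<lambda>y. f y t) has_field_derivative f' y t) (at y within ball z e)"
          by (simp add: has_field_derivative_at_within)
      next
        fix y assume "y \<in> ball z e"
        hence "y \<in> slit_plane" using e by blast
        hence "f y integrable_on {0..1}" by (intro integrable_continuous_real cont_f)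
        thus "f y integrable_on cbox 0 1" by simp
      next
        have "continuous_on (ball z e \<times> cbox 0 1) (\<lambda>p. euler_weight b c (snd p) * (a * of_real (snd p)
                  * (1 - fst p * of_real (snd p)) powr (- a - 1)))"
        proof (intro continuous_on_mult continuous_on_compose2[OF cont_w] continuous_on_powr_complex continuous_intros)
          show "ball z e \<times> cbox 0 1 \<subseteq> {p. Re (1 - fst p * of_real (snd p)) \<ge> 0 \<or> Im (1 - fst p * of_real (snd p)) \<noteq> 0}"
          proof
            fix p assume p: "p \<in> ball z e \<times> cbox 0 (1 :: real)"
            hence "fst p \<in> slit_plane" "0 \<le> snd p" "snd p \<le> 1" using e by (auto simp: mem_Times_iff)
            hence "1 - fst p * of_real (snd p) \<notin> \<real>\<^sub>\<le>\<^sub>0" by (rule one_minus_mult_slit_plane)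
            thus "p \<in> {p. Re (1 - fst p * of_real (snd p)) \<ge> 0 \<or> Im (1 - fst p * of_real (snd p)) \<noteq> 0}"
              unfolding complex_nonpos_Reals_iff mem_Collect_eq by linarith
          qed
          fix p assume p: "p \<in> ball z e \<times> cbox 0 1" "1 - fst p * of_real (snd p) = 0"
          have "fst p \<in> slit_plane" "0 \<le> snd p" "snd p \<le> 1" using e p(1) by (auto simp: mem_Times_iff)
          hence "1 - fst p * of_real (snd p) \<notin> \<real>\<^sub>\<le>\<^sub>0" by (rule one_minus_mult_slit_plane)
          thus "Re (- a - 1) > 0" unfolding p(2) by simp
        qed auto
        thus "continuous_on (ball z e \<times> cbox 0 1) (\<lambda>(y, t). f' y t)"
          by (simp add: f'_def case_prod_unfold)
      qed auto
      thus ?thesis using e by (intro exI[of _ "ball z e"]) auto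
    qed
    thus ?thesis
      by (subst holomorphic_on_open[OF open_slit_plane]) (meson holomorphic_on_open)
  qed
  hence "(\<lambda>z. Gamma c * rGamma b * rGamma (c - b) * integral {0..1} (f z)) holomorphic_on slit_plane"
    by (intro holomorphic_intros)
  thus ?thesis
    by (rule holomorphic_transform) (simp add: euler_integral_def int[symmetric] f_def)
qed

text \<open>Expand \<open>(1 - z t) powr (- a)\<close> by the binomial series and integrate termwise.\<close>

lemma euler_integral_series:
  assumes b: "Re b > 0" and cb: "Re (c - b) > 0" and z: "norm z < 1"
  shows "(\<lambda>n. gauss_coeff a b c n * z ^ n) sums euler_integral a b c z"
proof -
  let ?M = "restrict_space lborel {0<..<1::real}"
  define f where "f n t = pochhammer a n / fact n * z ^ n * (of_real t ^ n * euler_weight b c t)" for n and t :: real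
  define I where "I = (\<integral>t. norm (euler_weight b c t) \<partial>?M)"
  have c: "Re c > 0" using b cb by simp
  have sp: "space ?M = {0<..<1}" by (simp add: space_restrict_space)
  have w: "of_real t ^ n * euler_weight b c t = of_real t powr (b + of_nat n - 1) * of_real (1 - t) powr (c - b - 1)"
    if "t \<in> space ?M" for n t
    using that by (simp add: sp euler_weight_def powr_add powr_diff field_simps)
  have bn: "Re (b + of_nat n) > 0" for n using b by (simp add: add_pos_nonneg)
  have w_int: "integrable ?M (\<lambda>t. of_real t ^ n * euler_weight b c t)" for n
    using beta_integral_01(1)[OF bn cb, of n] by (subst Bochner_Integration.integrable_cong[OF refl w]) auto
  have w_val: "(\<integral>t. of_real t ^ n * euler_weight b c t \<partial>?M) = Gamma (b + of_nat n) * Gamma (c - b) * rGamma (c + of_nat n)" for n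
  proof -
    have "(\<integral>t. of_real t ^ n * euler_weight b c t \<partial>?M)
       = (\<integral>t. of_real t powr (b + of_nat n - 1) * of_real (1 - t) powr (c - b - 1) \<partial>?M)"
      by (intro Bochner_Integration.integral_cong refl w)
    thus ?thesis using beta_integral_01(2)[OF bn cb, of n] by (simp add: add_ac)
  qed
  have f_int: "integrable ?M (f n)" for n
    unfolding f_def by (intro integrable_mult_right w_int)
  have f_norm: "(\<integral>t. norm (f n t) \<partial>?M) \<le> norm (gauss_coeff a 1 1 n * z ^ n) * I" for n
  proof -
    have "(\<integral>t. norm (f n t) \<partial>?M) \<le> (\<integral>t. norm (gauss_coeff a 1 1 n * z ^ n) * norm (euler_weight b c t) \<partial>?M)"
    proof (rule integral_mono)
      show "integrable ?M (\<lambda>t. norm (f n t))" using f_int by (rule integrable_norm)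
      show "integrable ?M (\<lambda>t. norm (gauss_coeff a 1 1 n * z ^ n) * norm (euler_weight b c t))"
        using w_int[of 0] by (intro integrable_mult_right integrable_norm) simp
      fix t assume "t \<in> space ?M"
      hence "norm (of_real t :: complex) ^ n \<le> 1" by (intro power_le_one) (auto simp: sp)
      moreover have "gauss_coeff a 1 1 n = pochhammer a n / fact n"
        by (simp add: gauss_coeff_def flip: pochhammer_fact)
      ultimately show "norm (f n t) \<le> norm (gauss_coeff a 1 1 n * z ^ n) * norm (euler_weight b c t)"
        unfolding f_def norm_mult norm_power by (intro mult_mono) (auto intro!: mult_left_le_one_le)
    qed
    thus ?thesis by (simp add: I_def)
  qed
  have "summable (\<lambda>n. norm (gauss_coeff a 1 1 n * z ^ n) * I)"
    by (intro summable_mult2 summable_norm_gauss_coeff z) auto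
  note L1 = suminf_integral_L1(3)[OF f_int f_norm this]
  have "(\<Sum>n. f n t) = euler_weight b c t * (1 - z * of_real t) powr (- a)" if "t \<in> space ?M" for t
  proof -
    have "norm z * \<bar>t\<bar> < 1 * 1"
      using z that by (intro mult_strict_mono') (auto simp: sp)
    hence "norm (- (z * of_real t)) < 1" by (simp add: norm_mult)
    hence "(\<lambda>n. ((- a) gchoose n) * (- (z * of_real t)) ^ n * euler_weight b c t) sums
             ((1 + - (z * of_real t)) powr (- a) * euler_weight b c t)"
      by (intro sums_mult2 gen_binomial_complex)
    also have "(\<lambda>n. ((- a) gchoose n) * (- (z * of_real t)) ^ n * euler_weight b c t) = (\<lambda>n. f n t)"
    proof
      fix n
      have "((- a) gchoose n) * (- (z * of_real t)) ^ n * euler_weight b c t = ((-1) ^ n * (-1) ^ n) * f n t"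
        unfolding f_def gbinomial_pochhammer power_minus[of "z * of_real t"] power_mult_distrib by simp
      thus "((- a) gchoose n) * (- (z * of_real t)) ^ n * euler_weight b c t = f n t"
        by (simp flip: power_mult_distrib)
    qed
    finally show ?thesis by (simp add: sums_iff mult_ac)
  qed
  hence "(\<integral>t. (\<Sum>n. f n t) \<partial>?M) = (\<integral>t. euler_weight b c t * (1 - z * of_real t) powr (- a) \<partial>?M)"
    by (intro Bochner_Integration.integral_cong refl)
  hence "(\<lambda>n. Gamma c * rGamma b * rGamma (c - b) * integral\<^sup>L ?M (f n)) sums euler_integral a b c z"
    unfolding euler_integral_def using L1 by (intro sums_mult) simp
  also have "(\<lambda>n. Gamma c * rGamma b * rGamma (c - b) * integral\<^sup>L ?M (f n)) = (\<lambda>n. gauss_coeff a b c n * z ^ n)"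
  proof
    fix n
    have nz: "rGamma b \<noteq> 0" "rGamma (c - b) \<noteq> 0" "rGamma c \<noteq> 0" "rGamma (b + of_nat n) \<noteq> 0"
      using not_nonpos_Int_if_Re_pos[OF b] not_nonpos_Int_if_Re_pos[OF cb] not_nonpos_Int_if_Re_pos[OF c]
        not_nonpos_Int_if_Re_pos[OF bn] by (simp_all add: rGamma_eq_zero_iff)
    have 1: "rGamma b * Gamma (b + of_nat n) = pochhammer b n"
      using pochhammer_rGamma[of b n] nz by (simp add: Gamma_def)
    have 2: "Gamma c * rGamma (c + of_nat n) = 1 / pochhammer c n"
      using pochhammer_rGamma[of c n] nz pochhammer_nz[OF c, of n] by (simp add: Gamma_def field_simps)
    have "integral\<^sup>L ?M (f n) = pochhammer a n / fact n * z ^ n * (Gamma (b + of_nat n) * Gamma (c - b) * rGamma (c + of_nat n))"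
      unfolding f_def by (subst integral_mult_right_zero) (simp only: w_val)
    hence "Gamma c * rGamma b * rGamma (c - b) * integral\<^sup>L ?M (f n)
        = pochhammer a n / fact n * z ^ n * ((rGamma b * Gamma (b + of_nat n)) * (Gamma c * rGamma (c + of_nat n))
            * (rGamma (c - b) * Gamma (c - b)))"
      by simp
    also have "\<dots> = gauss_coeff a b c n * z ^ n"
      unfolding 1 2 using nz by (simp add: Gamma_def gauss_coeff_def field_simps)
    finally show "Gamma c * rGamma b * rGamma (c - b) * integral\<^sup>L ?M (f n) = gauss_coeff a b c n * z ^ n" .
  qed
  finally show ?thesis .
qed

text \<open>The reflection \<open>t \<mapsto> 1 - t\<close> exchanges \<open>b\<close> and \<open>c - b\<close>, and
  \<open>1 - v (1 - t) = (1 - v) (1 - v / (v - 1) t)\<close>.\<close>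

lemma euler_integral_pfaff:
  assumes v: "v < 0"
  shows "euler_integral a b c (of_real v)
       = of_real (1 - v) powr (- a) * euler_integral a (c - b) c (of_real (v / (v - 1)))"
proof -
  let ?I = "\<lambda>t. indicator {0<..<1} t *\<^sub>R (euler_weight b c t * (1 - of_real v * of_real t) powr (- a))"
  let ?J = "\<lambda>t. indicator {0<..<1} t *\<^sub>R (euler_weight (c - b) c t * (1 - of_real (v / (v - 1)) * of_real t) powr (- a))"
  have "integral\<^sup>L lborel ?I = \<bar>-1\<bar> *\<^sub>R (\<integral>t. ?I (1 + (-1) * t) \<partial>lborel)"
    by (rule lborel_integral_real_affine) simp
  also have "\<dots> = (\<integral>t. of_real (1 - v) powr (- a) * ?J t \<partial>lborel)"
  proof -
    have "?I (1 + (-1) * t) = of_real (1 - v) powr (- a) * ?J t" for t :: real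
    proof (cases "t \<in> {0<..<1}")
      case True
      have "v / (v - 1) * t < 1 * 1" using v True by (intro mult_strict_mono') (auto simp: divide_simps)
      hence pos: "1 - v / (v - 1) * t \<ge> 0" by simp
      have "(1 - complex_of_real v * of_real (1 - t)) = of_real ((1 - v) * (1 - v / (v - 1) * t))"
        using v by (simp add: divide_simps) (simp add: algebra_simps)
      also have "\<dots> powr (- a) = of_real (1 - v) powr (- a) * (of_real (1 - v / (v - 1) * t)) powr (- a)"
        unfolding of_real_mult[of "1 - v"] by (rule powr_times_real) (use v pos in auto)
      finally show ?thesis using True by (simp add: euler_weight_def)
    qed auto
    thus ?thesis by simp
  qed
  also have "\<dots> = of_real (1 - v) powr (- a) * integral\<^sup>L lborel ?J" by (rule integral_mult_right_zero)
  finally show ?thesis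
    by (simp add: euler_integral_def integral_restrict_space)
qed

section \<open>Existence, uniqueness and Pfaff's transformation of the branch\<close>

text \<open>The property by which \<open>hyp2F1\<close> is chosen.\<close>

definition gauss_branch :: "complex \<Rightarrow> complex \<Rightarrow> complex \<Rightarrow> (complex \<Rightarrow> complex) \<Rightarrow> bool" where
  "gauss_branch a b c F \<longleftrightarrow> F holomorphic_on slit_plane \<and>
     (\<forall>z. norm z < 1 \<longrightarrow> (\<lambda>n. gauss_coeff a b c n * z ^ n) sums F z)"

definition pfaff :: "complex \<Rightarrow> complex \<Rightarrow> complex \<Rightarrow> (complex \<Rightarrow> complex) \<Rightarrow> bool" where
  "pfaff a b c F \<longleftrightarrow> (\<forall>v<0. F (of_real v) =
     of_real (1 - v) powr (- a) * gauss_series a (c - b) c (of_real (v / (v - 1))))"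

lemma pfaffD:
  assumes "pfaff a b c F" "v < 0" "e = - a" "d = c - b"
  shows "F (of_real v) = of_real (1 - v) powr e * gauss_series a d c (of_real (v / (v - 1)))"
  using assms by (auto simp: pfaff_def)

lemma branch_exists_euler:
  assumes b: "Re b > 1" and cb: "Re (c - b) > 1"
  shows "\<exists>F. gauss_branch a b c F \<and> pfaff a b c F"
proof (intro exI conjI)
  have *: "euler_integral a (c - b) c z = gauss_series a (c - b) c z" if "norm z < 1" for z
    using euler_integral_series[of "c - b" c z a] that b cb
    by (simp add: gauss_series_def sums_iff)
  show "gauss_branch a b c (euler_integral a b c)"
    unfolding gauss_branch_def
    by (intro conjI allI impI euler_integral_holomorphic euler_integral_series) (use b cb in auto)
  show "pfaff a b c (euler_integral a b c)"
    unfolding pfaff_def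
  proof (intro allI impI)
    fix v :: real assume v: "v < 0"
    have "norm (complex_of_real (v / (v - 1))) < 1" using v by (simp only: norm_of_real) (simp add: divide_simps)
    from *[OF this] show "euler_integral a b c (of_real v) =
     of_real (1 - v) powr (- a) * gauss_series a (c - b) c (of_real (v / (v - 1)))"
      by (subst euler_integral_pfaff[OF v]) simp
  qed
qed

lemma pfaff_variable_bounds:
  fixes v :: real
  assumes "v < 0"
  shows "norm (complex_of_real (v / (v - 1))) < 1"
    "of_real (1 - v) powr (- a - 1) * complex_of_real v = - (of_real (1 - v) powr (- a) * of_real (v / (v - 1)))"
proof -
  show "norm (complex_of_real (v / (v - 1))) < 1" using assms by (simp only: norm_of_real) (simp add: divide_simps)
  have nz: "complex_of_real (v - 1) \<noteq> 0" "complex_of_real (1 - v) \<noteq> 0" using assms by (simp_all only: of_real_eq_0_iff)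
  have "complex_of_real (1 - v) powr (- a - 1) = of_real (1 - v) powr (- a) / of_real (1 - v)"
    using nz by (subst powr_diff) simp
  moreover have "complex_of_real (v / (v - 1)) = - (of_real v / of_real (1 - v))"
  proof -
    have "v / (v - 1) = - (v / (1 - v))" using assms by (simp add: divide_simps) (simp add: algebra_simps)
    thus ?thesis by (metis of_real_divide of_real_minus)
  qed
  ultimately show "of_real (1 - v) powr (- a - 1) * complex_of_real v = - (of_real (1 - v) powr (- a) * of_real (v / (v - 1)))"
    by simp
qed

lemma branch_exists_lower_c:
  assumes c: "Re c > 0"
    and F: "gauss_branch a b (c + 1) F" "pfaff a b (c + 1) F"
    and G: "gauss_branch (a + 1) (b + 1) (c + 2) G" "pfaff (a + 1) (b + 1) (c + 2) G"
  shows "\<exists>F. gauss_branch a b c F \<and> pfaff a b c F"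
proof (intro exI conjI)
  let ?H = "\<lambda>z. F z + a * b / (c * (c + 1)) * z * G z"
  show "gauss_branch a b c ?H"
    unfolding gauss_branch_def
  proof (intro conjI allI impI)
    show "?H holomorphic_on slit_plane"
      using F(1) G(1) unfolding gauss_branch_def by (intro holomorphic_intros) auto
    show "(\<lambda>n. gauss_coeff a b c n * z ^ n) sums ?H z" if "norm z < 1" for z
      by (rule power_series_combine[where p = "gauss_coeff a b c" and q = "gauss_coeff a b (c + 1)"
               and r = "gauss_coeff (a + 1) (b + 1) (c + 2)", OF _ _ _ gauss_coeff_raise_c[OF c]])
         (use F(1) G(1) that in \<open>auto simp: gauss_branch_def\<close>)
  qed
  show "pfaff a b c ?H"
    unfolding pfaff_def
  proof (intro allI impI)
    fix v :: real assume v: "v < 0"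
    define y where "y = complex_of_real (v / (v - 1))"
    note y = pfaff_variable_bounds[OF v, folded y_def]
    define S where "S = gauss_series a (c - b + 1) (c + 1) y"
    define T where "T = gauss_series (a + 1) (c - b + 1) (c + 2) y"
    have "(\<lambda>n. gauss_coeff a (c - b) c n * y ^ n) sums (S + (- a * b / (c * (c + 1))) * y * T)"
      unfolding S_def T_def
      by (rule power_series_combine[OF gauss_series_sums gauss_series_sums])
         (use c y(1) gauss_coeff_raise_bc[OF c, of a "c - b"] in auto)
    moreover have "(\<lambda>n. gauss_coeff a (c - b) c n * y ^ n) sums gauss_series a (c - b) c y"
      by (rule gauss_series_sums[OF c y(1)])
    ultimately have eq: "gauss_series a (c - b) c y = S + (- a * b / (c * (c + 1))) * y * T"
      by (rule sums_unique2[rotated])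
    have "F (of_real v) = of_real (1 - v) powr (- a) * S"
      unfolding S_def y_def by (rule pfaffD[OF F(2) v]) auto
    moreover have "G (of_real v) = of_real (1 - v) powr (- a - 1) * T"
      unfolding T_def y_def by (rule pfaffD[OF G(2) v]) auto
    ultimately have "?H (of_real v) = of_real (1 - v) powr (- a) * S
        + a * b / (c * (c + 1)) * (of_real (1 - v) powr (- a - 1) * of_real v) * T"
      by simp
    also have "\<dots> = of_real (1 - v) powr (- a) * (S + (- a * b / (c * (c + 1))) * y * T)"
      unfolding y(2) by (simp add: algebra_simps)
    finally show "?H (of_real v) = of_real (1 - v) powr (- a) * gauss_series a (c - b) c (of_real (v / (v - 1)))"
      unfolding y_def[symmetric] eq .
  qed
qed

lemma branch_exists_lower_b:
  assumes c: "Re c > 0"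
    and F: "gauss_branch a (b + 1) c F" "pfaff a (b + 1) c F"
    and G: "gauss_branch (a + 1) (b + 1) (c + 1) G" "pfaff (a + 1) (b + 1) (c + 1) G"
  shows "\<exists>F. gauss_branch a b c F \<and> pfaff a b c F"
proof (intro exI conjI)
  let ?H = "\<lambda>z. F z + (- a / c) * z * G z"
  show "gauss_branch a b c ?H"
    unfolding gauss_branch_def
  proof (intro conjI allI impI)
    show "?H holomorphic_on slit_plane"
      using F(1) G(1) unfolding gauss_branch_def by (intro holomorphic_intros) auto
    show "(\<lambda>n. gauss_coeff a b c n * z ^ n) sums ?H z" if "norm z < 1" for z
      by (rule power_series_combine[where p = "gauss_coeff a b c" and q = "gauss_coeff a (b + 1) c"
               and r = "gauss_coeff (a + 1) (b + 1) (c + 1)", OF _ _ _ gauss_coeff_raise_b[OF c]])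
         (use F(1) G(1) that in \<open>auto simp: gauss_branch_def\<close>)
  qed
  show "pfaff a b c ?H"
    unfolding pfaff_def
  proof (intro allI impI)
    fix v :: real assume v: "v < 0"
    define y where "y = complex_of_real (v / (v - 1))"
    note y = pfaff_variable_bounds[OF v, folded y_def]
    define S where "S = gauss_series a (c - b - 1) c y"
    define R where "R = gauss_series a (c - b) c y"
    define T where "T = gauss_series (a + 1) (c - b) (c + 1) y"
    have "(\<lambda>n. gauss_coeff a (c - b - 1) c n * y ^ n) sums (R + (- a / c) * y * T)"
      unfolding R_def T_def
      by (rule power_series_combine[OF gauss_series_sums gauss_series_sums])
         (use c y(1) gauss_coeff_raise_b[OF c, of a "c - b - 1"] in auto)
    moreover have "(\<lambda>n. gauss_coeff a (c - b - 1) c n * y ^ n) sums S"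
      unfolding S_def by (rule gauss_series_sums[OF c y(1)])
    ultimately have eq: "S = R + (- a / c) * y * T"
      by (rule sums_unique2[rotated])
    have "F (of_real v) = of_real (1 - v) powr (- a) * S"
      unfolding S_def y_def by (rule pfaffD[OF F(2) v]) auto
    moreover have "G (of_real v) = of_real (1 - v) powr (- a - 1) * T"
      unfolding T_def y_def by (rule pfaffD[OF G(2) v]) auto
    ultimately have "?H (of_real v) = of_real (1 - v) powr (- a) * S
        + (- a / c) * (of_real (1 - v) powr (- a - 1) * of_real v) * T"
      by simp
    also have "\<dots> = of_real (1 - v) powr (- a) * R"
      unfolding y(2) eq by (simp add: algebra_simps)
    finally show "?H (of_real v) = of_real (1 - v) powr (- a) * gauss_series a (c - b) c (of_real (v / (v - 1)))"
      unfolding y_def[symmetric] R_def[symmetric] .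
  qed
qed

text \<open>Start from Euler's integral, then lower \<open>c\<close> and afterwards \<open>b\<close>, one unit at a time.  Each step refers to
  parameters in which \<open>c - b\<close>, respectively \<open>b\<close>, is larger by 1.\<close>

lemma branch_exists:
  assumes c: "Re c > 0"
  shows "\<exists>F. gauss_branch a b c F \<and> pfaff a b c F"
proof -
  have 1: "\<exists>F. gauss_branch a b c F \<and> pfaff a b c F"
    if "Re b > 1" "Re c > 0" "Re (c - b) > 1 - real N" for N a b c
    using that
  proof (induction N arbitrary: a b c)
    case 0
    thus ?case by (intro branch_exists_euler) auto
  next
    case (Suc N)
    have "\<exists>F. gauss_branch a b (c + 1) F \<and> pfaff a b (c + 1) F"
      "\<exists>F. gauss_branch (a + 1) (b + 1) (c + 2) F \<and> pfaff (a + 1) (b + 1) (c + 2) F"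
      using Suc.prems by (auto intro!: Suc.IH)
    thus ?case using branch_exists_lower_c[OF Suc.prems(2)] by blast
  qed
  have 2: "\<exists>F. gauss_branch a b c F \<and> pfaff a b c F"
    if "Re c > 0" "Re b > 1 - real N" for N a b c
    using that
  proof (induction N arbitrary: a b c)
    case 0
    obtain N where "1 - Re (c - b) < real N" using reals_Archimedean2 by blast
    thus ?case using 0 by (intro 1[of _ _ N]) auto
  next
    case (Suc N)
    have "\<exists>F. gauss_branch a (b + 1) c F \<and> pfaff a (b + 1) c F"
      "\<exists>F. gauss_branch (a + 1) (b + 1) (c + 1) F \<and> pfaff (a + 1) (b + 1) (c + 1) F"
      using Suc.prems by (auto intro!: Suc.IH)
    thus ?case using branch_exists_lower_b[OF Suc.prems(1)] by blast
  qed
  obtain N where "1 - Re b < real N" using reals_Archimedean2 by blast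
  thus ?thesis using c by (intro 2[of _ N]) auto
qed

lemma gauss_branch_unique:
  assumes "gauss_branch a b c F" "gauss_branch a b c G" "z \<in> slit_plane"
  shows "F z = G z"
proof (rule analytic_continuation_open[of "ball 0 1" slit_plane F G])
  fix z :: complex assume "z \<in> ball 0 1"
  thus "F z = G z" using assms by (auto simp: gauss_branch_def dest: sums_unique2)
qed (use assms open_slit_plane connected_slit_plane ball_subset_slit_plane in \<open>auto simp: gauss_branch_def\<close>)

lemma hyp2F1_branch:
  assumes c: "Re c > 0"
  shows "gauss_branch a b c (hyp2F1 a b c)" and "pfaff a b c (hyp2F1 a b c)"
proof -
  obtain F where F: "gauss_branch a b c F" "pfaff a b c F" using branch_exists[OF c] by blast
  have "hyp2F1 a b c = (SOME F. gauss_branch a b c F)"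
    unfolding hyp2F1_def gauss_branch_def gauss_coeff_def ..
  thus *: "gauss_branch a b c (hyp2F1 a b c)"
    using someI[of "gauss_branch a b c", OF F(1)] by simp
  show "pfaff a b c (hyp2F1 a b c)"
    unfolding pfaff_def
  proof (intro allI impI)
    fix v :: real assume v: "v < 0"
    hence "complex_of_real v \<in> slit_plane" unfolding slit_plane_iff by simp
    from gauss_branch_unique[OF * F(1) this] F(2) v
    show "hyp2F1 a b c (of_real v) = of_real (1 - v) powr (- a) * gauss_series a (c - b) c (of_real (v / (v - 1)))"
      by (simp add: pfaff_def)
  qed
qed

text \<open>The contiguous relation behind the descent in \<open>\<alpha>'\<close>.  It holds on the disc by comparing
  coefficients, and on the slit plane because its right-hand side is another branch.\<close>

lemma hyp2F1_raise_a:
  assumes c: "Re c > 0" and z: "z \<in> slit_plane"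
  shows "hyp2F1 a b c z = hyp2F1 (a + 1) b c z - b / c * z * hyp2F1 (a + 1) (b + 1) (c + 1) z"
proof -
  let ?H = "\<lambda>z. hyp2F1 (a + 1) b c z + (- b / c) * z * hyp2F1 (a + 1) (b + 1) (c + 1) z"
  have F: "gauss_branch (a + 1) b c (hyp2F1 (a + 1) b c)"
    and G: "gauss_branch (a + 1) (b + 1) (c + 1) (hyp2F1 (a + 1) (b + 1) (c + 1))"
    using c by (auto intro!: hyp2F1_branch)
  have rec: "gauss_coeff a b c (Suc n) = gauss_coeff (a + 1) b c (Suc n)
     + (- b / c) * gauss_coeff (a + 1) (b + 1) (c + 1) n" for n
    using gauss_coeff_raise_b[OF c, of b a n]
    by (simp only: gauss_coeff_commute[of b] gauss_coeff_commute[of "b + 1"])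
  have "gauss_branch a b c ?H"
    unfolding gauss_branch_def
  proof (intro conjI allI impI)
    show "?H holomorphic_on slit_plane"
      using F G unfolding gauss_branch_def by (intro holomorphic_intros) auto
    show "(\<lambda>n. gauss_coeff a b c n * z ^ n) sums ?H z" if "norm z < 1" for z
      by (rule power_series_combine[where p = "gauss_coeff a b c" and q = "gauss_coeff (a + 1) b c"
               and r = "gauss_coeff (a + 1) (b + 1) (c + 1)", OF _ _ _ rec])
         (use F G that in \<open>auto simp: gauss_branch_def\<close>)
  qed
  from gauss_branch_unique[OF hyp2F1_branch(1)[OF c] this z] show ?thesis by simp
qed

section \<open>The integral of a single Gauss function\<close>

lemma of_real_powr_shift:
  assumes "x > 0"
  shows "complex_of_real x powr (z + of_nat n) = of_real x powr z * of_real x ^ n"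
    and "complex_of_real x powr (z - of_nat n) = of_real x powr z / of_real x ^ n"
  using assms by (simp_all add: powr_add powr_diff)

lemma beta_integral_Ioi_norm:
  fixes c d :: complex and x :: real
  assumes c: "Re c > 0" and d: "Re d > 0" and x: "x > 0"
  shows "(\<integral>t. norm (complex_of_real (t - x) powr (c - 1) * of_real t powr (- c - d)) \<partial>restrict_space lborel {x<..})
         = x powr (- Re d) * (Gamma (Re c) * Gamma (Re d) * rGamma (Re c + Re d))"
proof -
  let ?M = "restrict_space lborel {x<..}"
  let ?c = "complex_of_real (Re c)" and ?d = "complex_of_real (Re d)"
  have "complex_of_real (\<integral>t. norm (complex_of_real (t - x) powr (c - 1) * of_real t powr (- c - d)) \<partial>?M)
      = (\<integral>t. of_real (norm (complex_of_real (t - x) powr (c - 1) * of_real t powr (- c - d))) \<partial>?M)"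
    by (rule integral_complex_of_real [symmetric])
  also have "\<dots> = (\<integral>t. of_real (t - x) powr (?c - 1) * of_real t powr (- ?c - ?d) \<partial>?M)"
  proof (intro Bochner_Integration.integral_cong refl)
    fix t assume "t \<in> space ?M"
    hence t: "t > x" "t > 0" using x by (auto simp: space_restrict_space)
    have "norm (complex_of_real (t - x) powr (c - 1) * of_real t powr (- c - d))
        = (t - x) powr (Re c - 1) * t powr (- Re c - Re d)"
      using t by (simp add: norm_mult norm_powr_real_powr flip: of_real_diff)
    also have "complex_of_real \<dots> = of_real (t - x) powr of_real (Re c - 1) * of_real t powr of_real (- Re c - Re d)"
      unfolding of_real_mult using t by (simp only: powr_of_real)
    finally show "complex_of_real (norm (complex_of_real (t - x) powr (c - 1) * of_real t powr (- c - d)))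
        = of_real (t - x) powr (?c - 1) * of_real t powr (- ?c - ?d)"
      by simp
  qed
  also have "\<dots> = of_real x powr (- ?d) * (Gamma ?c * Gamma ?d * rGamma (?c + ?d))"
    using c d x by (intro beta_integral_Ioi) auto
  also have "\<dots> = of_real (x powr (- Re d) * (Gamma (Re c) * Gamma (Re d) * rGamma (Re c + Re d)))"
    using x by (simp add: Gamma_complex_of_real rGamma_complex_of_real powr_of_real
                     flip: of_real_add of_real_minus)
  finally show ?thesis by (simp only: of_real_eq_iff)
qed

lemma norm_pochhammer_ge:
  assumes "Re c > 0"
  shows "norm (pochhammer c n) \<ge> pochhammer (Re c) n"
  unfolding pochhammer_prod prod_norm[symmetric]
  by (intro prod_mono) (use assms in \<open>auto intro: order.trans[OF _ complex_Re_le_cmod]\<close>)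

text \<open>In norm estimates this cancels the Gamma factor of the Beta integral against the lower
  Pochhammer symbol.\<close>

lemma Gamma_over_norm_pochhammer_le:
  assumes "Re c > 0"
  shows "Gamma (Re c + real n) / norm (pochhammer c n) \<le> Gamma (Re c)"
proof -
  have "Re c \<notin> \<int>\<^sub>\<le>\<^sub>0" using assms by (auto elim!: nonpos_Ints_cases)
  hence "pochhammer (Re c) n = Gamma (Re c + real n) / Gamma (Re c)" by (rule pochhammer_Gamma)
  hence "Gamma (Re c + real n) = Gamma (Re c) * pochhammer (Re c) n"
    using Gamma_real_pos[OF assms] by (simp add: field_simps)
  also have "\<dots> \<le> Gamma (Re c) * norm (pochhammer c n)"
    using norm_pochhammer_ge[OF assms] Gamma_real_pos[OF assms] by (intro mult_left_mono) auto
  finally show ?thesis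
    using pochhammer_nz[OF assms, of n] by (simp add: divide_simps mult_ac)
qed

text \<open>By Pfaff's transformation the integrand is a series of Beta integrands in the variable
  \<open>1 - x / t\<close>; the resulting series of Beta values is a Gauss sum.  The \<open>L\<^sup>1\<close> bound is kept as
  a series because it has to be estimated uniformly when \<open>c\<close> runs through \<open>\<gamma> + m\<close>.\<close>

lemma integral_hyp2F1:
  fixes a b c \<delta> :: complex and x :: real
  assumes c: "Re c > 0" and a: "Re (a + \<delta>) > 0" and b: "Re (b + \<delta>) > 0" and x: "x > 0"
  defines "M \<equiv> restrict_space lborel {x<..}"
  defines "h \<equiv> (\<lambda>t. of_real (t - x) powr (c - 1) * of_real t powr (- c - \<delta>) * hyp2F1 a b c (of_real (1 - t / x)))"
  shows "integrable M h"
    and "integral\<^sup>L M h = of_real x powr (- \<delta>) * Gamma c * Gamma (a + \<delta>) * Gamma (b + \<delta>)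
            * rGamma (a + b + \<delta>) * rGamma (c + \<delta>)"
    and "(\<integral>t. norm (h t) \<partial>M) \<le> x powr (- Re \<delta>) * Gamma (Re c) * Gamma (Re (a + \<delta>))
            * (\<Sum>n. norm (gauss_term a (c - b) (of_real (Re (c + a + \<delta>))) n))"
proof -
  define B where "B n t = complex_of_real (t - x) powr (c + of_nat n - 1) * of_real t powr (- (c + of_nat n) - (a + \<delta>))" for n t
  define f where "f n t = gauss_coeff a (c - b) c n * of_real x powr a * B n t" for n t
  define C where "C = x powr (- Re \<delta>) * Gamma (Re c) * Gamma (Re (a + \<delta>))"
  have cn: "Re (c + of_nat n) > 0" for n using c by (simp add: add_pos_nonneg)
  have f_int: "integrable M (f n)" for n
    unfolding f_def B_def M_def by (intro integrable_mult_right beta_integral_Ioi cn a x)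
  have f_val: "integral\<^sup>L M (f n) = of_real x powr (- \<delta>) * Gamma c * Gamma (a + \<delta>)
      * gauss_term a (c - b) (c + a + \<delta>) n" for n
  proof -
    have nz: "rGamma c \<noteq> 0" "rGamma (c + of_nat n) \<noteq> 0"
      using not_nonpos_Int_if_Re_pos[OF c] not_nonpos_Int_if_Re_pos[OF cn] by (simp_all add: rGamma_eq_zero_iff)
    have G: "Gamma (c + of_nat n) = Gamma c * pochhammer c n"
      using pochhammer_rGamma[of c n] nz by (simp add: Gamma_def field_simps)
    have xx: "complex_of_real x powr a * of_real x powr (- (a + \<delta>)) = of_real x powr (- \<delta>)"
      using x by (simp flip: powr_add)
    have "integral\<^sup>L M (f n) = gauss_coeff a (c - b) c n * of_real x powr a *
       (of_real x powr (- (a + \<delta>)) * (Gamma (c + of_nat n) * Gamma (a + \<delta>) * rGamma (c + of_nat n + (a + \<delta>))))"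
      unfolding f_def integral_mult_right_zero B_def M_def by (subst beta_integral_Ioi(2)[OF cn a x]) simp
    also have "\<dots> = (of_real x powr a * of_real x powr (- (a + \<delta>))) * Gamma (c + of_nat n) * Gamma (a + \<delta>)
        * (gauss_coeff a (c - b) c n * rGamma (c + a + \<delta> + of_nat n))"
      by (simp add: add_ac)
    also have "\<dots> = of_real x powr (- \<delta>) * Gamma c * Gamma (a + \<delta>) * gauss_term a (c - b) (c + a + \<delta>) n"
      unfolding xx G using pochhammer_nz[OF c, of n] by (simp add: gauss_coeff_def gauss_term_def field_simps)
    finally show ?thesis .
  qed
  have f_norm: "(\<integral>t. norm (f n t) \<partial>M) \<le> C * norm (gauss_term a (c - b) (of_real (Re (c + a + \<delta>))) n)" for n
  proof -
    define r where "r = Re (c + a + \<delta>) + real n"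
    have r: "r > 0" using c a by (simp add: r_def add_pos_nonneg)
    have xx: "x powr Re a * x powr (- Re (a + \<delta>)) = x powr (- Re \<delta>)"
      using x by (simp flip: powr_add)
    have p: "rGamma r \<ge> 0" using Gamma_real_pos[OF r] by (simp add: rGamma_inverse_Gamma)
    have p': "Gamma (Re (a + \<delta>)) > 0" by (rule Gamma_real_pos[OF a])
    have "(\<integral>t. norm (f n t) \<partial>M) = norm (gauss_coeff a (c - b) c n) * x powr Re a *
       (x powr (- Re (a + \<delta>)) * (Gamma (Re c + real n) * Gamma (Re (a + \<delta>)) * rGamma r))"
    proof -
      have "(\<integral>t. norm (f n t) \<partial>M) = norm (gauss_coeff a (c - b) c n) * x powr Re a * (\<integral>t. norm (B n t) \<partial>M)"
        unfolding f_def norm_mult[of "_ * _" "B n _"] integral_mult_right_zero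
        using x by (simp add: norm_mult norm_powr_real_powr)
      also have "(\<integral>t. norm (B n t) \<partial>M) = x powr (- Re (a + \<delta>)) * (Gamma (Re (c + of_nat n)) * Gamma (Re (a + \<delta>)) * rGamma (Re (c + of_nat n) + Re (a + \<delta>)))"
        unfolding B_def M_def by (rule beta_integral_Ioi_norm[OF cn a x])
      finally show ?thesis by (simp add: r_def add_ac)
    qed
    also have "\<dots> = x powr (- Re \<delta>) * (Gamma (Re c + real n) / norm (pochhammer c n)) * Gamma (Re (a + \<delta>))
        * (norm (pochhammer a n * pochhammer (c - b) n / fact n) * rGamma r)"
      unfolding xx[symmetric] by (simp add: gauss_coeff_def norm_mult norm_divide)
    also have "\<dots> \<le> x powr (- Re \<delta>) * Gamma (Re c) * Gamma (Re (a + \<delta>))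
        * (norm (pochhammer a n * pochhammer (c - b) n / fact n) * rGamma r)"
      using p p' by (intro mult_right_mono mult_left_mono Gamma_over_norm_pochhammer_le c) auto
    also have "norm (pochhammer a n * pochhammer (c - b) n / fact n) * rGamma r
        = norm (gauss_term a (c - b) (of_real (Re (c + a + \<delta>))) n)"
    proof -
      have "of_real (Re (c + a + \<delta>)) + of_nat n = complex_of_real r" by (simp add: r_def)
      thus ?thesis using p unfolding gauss_term_def norm_mult by (simp only: rGamma_complex_of_real norm_of_real)
    qed
    finally show ?thesis by (simp only: C_def)
  qed
  have summ: "summable (\<lambda>n. norm (gauss_term a (c - b) (of_real (Re (c + a + \<delta>))) n))"
    by (rule summable_norm_gauss_term) (use b in simp)
  note L1 = suminf_integral_L1[OF f_int f_norm summable_mult[OF summ]]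
  have sum_eq: "(\<Sum>n. f n t) = h t" if "t \<in> space M" for t
  proof -
    have t: "t > x" "t > 0" "t / x > 0" using that x by (auto simp: M_def space_restrict_space)
    define u where "u = complex_of_real (1 - x / t)"
    have v: "1 - t / x < 0" using t x by (simp add: field_simps)
    have arg: "(1 - t / x) / (1 - t / x - 1) = 1 - x / t" "1 - (1 - t / x) = t / x"
      using t x by (simp_all add: field_simps)
    have u1: "norm u < 1" unfolding u_def norm_of_real using t x by simp
    have tx: "complex_of_real (t / x) powr (- a) = of_real t powr (- a) * of_real x powr a"
    proof -
      have "complex_of_real t powr (- a) = of_real (t / x) powr (- a) * of_real x powr (- a)"
        using t x powr_times_real[of "of_real (t / x)" "of_real x" "- a"] by (simp add: of_real_divide)
      thus ?thesis using x by (simp add: powr_minus field_simps)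
    qed
    have hyp: "hyp2F1 a b c (of_real (1 - t / x)) = of_real t powr (- a) * of_real x powr a * gauss_series a (c - b) c u"
      using pfaffD[OF hyp2F1_branch(2)[OF c] v refl refl, of a b]
      unfolding arg tx u_def .
    have "(\<lambda>n. of_real (t - x) powr (c - 1) * of_real t powr (- c - \<delta>) * (of_real t powr (- a) * of_real x powr a)
              * (gauss_coeff a (c - b) c n * u ^ n)) sums
          (of_real (t - x) powr (c - 1) * of_real t powr (- c - \<delta>) * (of_real t powr (- a) * of_real x powr a)
              * gauss_series a (c - b) c u)"
      by (intro sums_mult gauss_series_sums c u1)
    also have "(\<lambda>n. of_real (t - x) powr (c - 1) * of_real t powr (- c - \<delta>) * (of_real t powr (- a) * of_real x powr a)
              * (gauss_coeff a (c - b) c n * u ^ n)) = (\<lambda>n. f n t)"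
    proof
      fix n
      have tx: "t - x > 0" using t by simp
      have "complex_of_real (t - x) powr (c + of_nat n - 1) = of_real (t - x) powr (c - 1) * of_real (t - x) ^ n"
        using of_real_powr_shift(1)[OF tx, of "c - 1" n] by (simp only: diff_add_eq)
      moreover have "complex_of_real t powr (- (c + of_nat n) - (a + \<delta>)) = of_real t powr (- c - \<delta>) * of_real t powr (- a) / of_real t ^ n"
      proof -
        have "- (c + of_nat n) - (a + \<delta>) = (- c - \<delta> + - a) - of_nat n" by simp
        thus ?thesis using of_real_powr_shift(2)[OF t(2), of "- c - \<delta> + - a" n] by (simp only: powr_add)
      qed
      moreover have "u ^ n = of_real (t - x) ^ n / of_real t ^ n"
      proof -
        have "u = of_real (t - x) / of_real t" using t by (simp add: u_def field_simps)
        thus ?thesis by (simp only: power_divide)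
      qed
      ultimately show "of_real (t - x) powr (c - 1) * of_real t powr (- c - \<delta>) * (of_real t powr (- a) * of_real x powr a)
              * (gauss_coeff a (c - b) c n * u ^ n) = f n t"
        unfolding f_def B_def by simp
    qed
    finally have "(\<Sum>n. f n t) = of_real (t - x) powr (c - 1) * of_real t powr (- c - \<delta>) * (of_real t powr (- a) * of_real x powr a)
              * gauss_series a (c - b) c u" by (simp add: sums_iff)
    also have "\<dots> = h t" unfolding h_def hyp by (simp only: mult.assoc)
    finally show ?thesis .
  qed
  have eq: "integrable M (\<lambda>t. \<Sum>n. f n t) = integrable M h"
    "(\<integral>t. (\<Sum>n. f n t) \<partial>M) = integral\<^sup>L M h"
    "(\<integral>t. norm (\<Sum>n. f n t) \<partial>M) = (\<integral>t. norm (h t) \<partial>M)"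
    by (intro Bochner_Integration.integrable_cong Bochner_Integration.integral_cong refl
          arg_cong[where f = norm] sum_eq; assumption)+
  show "integrable M h" using L1(2) unfolding eq .
  show "(\<integral>t. norm (h t) \<partial>M) \<le> x powr (- Re \<delta>) * Gamma (Re c) * Gamma (Re (a + \<delta>))
            * (\<Sum>n. norm (gauss_term a (c - b) (of_real (Re (c + a + \<delta>))) n))"
    using L1(4) unfolding eq suminf_mult[OF summ] C_def .
  have "(\<lambda>n. integral\<^sup>L M (f n)) sums (of_real x powr (- \<delta>) * Gamma c * Gamma (a + \<delta>) *
     (Gamma (c + a + \<delta> - a - (c - b)) * rGamma (c + a + \<delta> - a) * rGamma (c + a + \<delta> - (c - b))))"
    unfolding f_val by (intro sums_mult gauss_sum) (use b in simp)
  from sums_unique2[OF L1(3) this]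
  show "integral\<^sup>L M h = of_real x powr (- \<delta>) * Gamma c * Gamma (a + \<delta>) * Gamma (b + \<delta>)
            * rGamma (a + b + \<delta>) * rGamma (c + \<delta>)"
    unfolding eq by (simp add: algebra_simps)
qed

section \<open>Summability of the double series\<close>

text \<open>Far to the right the imaginary part of \<open>z\<close> costs less than any prescribed \<open>\<epsilon>\<close>.\<close>

lemma norm_add_nat_le_eventually:
  fixes z :: complex
  assumes "\<epsilon> > 0"
  obtains J where "\<And>j. j \<ge> J \<Longrightarrow> norm (z + of_nat j) \<le> Re z + \<epsilon> + real j"
    and "\<And>j. j \<ge> J \<Longrightarrow> Re z + real j > 0"
proof -
  obtain J where J: "(Im z)\<^sup>2 / (2 * \<epsilon>) + \<bar>Re z\<bar> < real J" using reals_Archimedean2 by blast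
  have q: "(Im z)\<^sup>2 / (2 * \<epsilon>) \<ge> 0" using assms by simp
  have "norm (z + of_nat j) \<le> Re z + \<epsilon> + real j" "Re z + real j > 0" if "j \<ge> J" for j
  proof -
    have 1: "(Im z)\<^sup>2 / (2 * \<epsilon>) < Re z + real j" using J that by linarith
    thus 2: "Re z + real j > 0" using q by linarith
    have "(Im z)\<^sup>2 < 2 * \<epsilon> * (Re z + real j)" using 1 assms by (simp add: field_simps)
    moreover have "(norm (z + of_nat j))\<^sup>2 = (Re z + real j)\<^sup>2 + (Im z)\<^sup>2"
      by (simp add: cmod_power2)
    moreover have "(Re z + \<epsilon> + real j)\<^sup>2 = (Re z + real j)\<^sup>2 + 2 * \<epsilon> * (Re z + real j) + \<epsilon>\<^sup>2"
      by (simp add: power2_eq_square algebra_simps)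
    moreover have "\<epsilon>\<^sup>2 \<ge> 0" by simp
    ultimately have "(norm (z + of_nat j))\<^sup>2 \<le> (Re z + \<epsilon> + real j)\<^sup>2" by linarith
    thus "norm (z + of_nat j) \<le> Re z + \<epsilon> + real j"
      by (rule power2_le_imp_le) (use 2 assms in simp)
  qed
  thus ?thesis using that by blast
qed

text \<open>All but finitely many factors on the left are bounded by those on the right; the constant
  takes care of the others.\<close>

lemma norm_pochhammer_le:
  fixes a :: complex
  assumes a: "Re a > 0" and \<epsilon>: "\<epsilon> > 0"
  obtains C where "\<And>n. norm (pochhammer a n) \<le> C * pochhammer (Re a + \<epsilon>) n"
proof -
  obtain J where J: "\<And>j. j \<ge> J \<Longrightarrow> norm (a + of_nat j) \<le> Re a + \<epsilon> + real j"
    using norm_add_nat_le_eventually[OF \<epsilon>, of a] by blast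
  have pos: "pochhammer (Re a + \<epsilon>) n > 0" for n using a \<epsilon> by (intro pochhammer_pos) auto
  define C where "C = (\<Sum>k\<le>J. norm (pochhammer a k) / pochhammer (Re a + \<epsilon>) k)"
  have nonneg: "norm (pochhammer a k) / pochhammer (Re a + \<epsilon>) k \<ge> 0" for k
    using pos[of k] by simp
  have "norm (pochhammer a n) \<le> C * pochhammer (Re a + \<epsilon>) n" for n
  proof (induction n)
    case (Suc n)
    show ?case
    proof (cases "n \<ge> J")
      case True
      have "norm (pochhammer a (Suc n)) \<le> (C * pochhammer (Re a + \<epsilon>) n) * (Re a + \<epsilon> + real n)"
        unfolding pochhammer_Suc norm_mult by (intro mult_mono Suc.IH J True) (use Suc.IH in \<open>auto intro: order.trans[OF norm_ge_zero]\<close>)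
      thus ?thesis by (simp add: pochhammer_Suc)
    next
      case False
      hence "norm (pochhammer a (Suc n)) / pochhammer (Re a + \<epsilon>) (Suc n) \<le> C"
        unfolding C_def by (intro member_le_sum nonneg) auto
      thus ?thesis using pos[of "Suc n"] by (simp add: divide_simps del: pochhammer_Suc)
    qed
  next
    case 0
    have "norm (pochhammer a 0) / pochhammer (Re a + \<epsilon>) 0 \<le> C"
      unfolding C_def by (intro member_le_sum nonneg) auto
    thus ?case by simp
  qed
  thus ?thesis by (rule that)
qed

lemma gauss_sum_real:
  fixes u v w :: real
  assumes "u > 0" "v > 0" "w > 0" "w - u - v > 0"
  shows "(\<lambda>n. norm (gauss_term (of_real u) (of_real v) (of_real w) n)) sums
     norm (Gamma (of_real (w - u - v)) * rGamma (of_real (w - u)) * rGamma (of_real (w - v)) :: complex)"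
proof -
  define r where "r n = pochhammer u n * pochhammer v n / fact n * rGamma (w + real n)" for n
  let ?V = "Gamma (of_real (w - u - v)) * rGamma (of_real (w - u)) * rGamma (of_real (w - v)) :: complex"
  have r: "gauss_term (of_real u) (of_real v) (of_real w) n = of_real (r n)" for n
  proof -
    have "rGamma (of_real w + of_nat n) = complex_of_real (rGamma (w + real n))"
      using rGamma_complex_of_real[of "w + real n"] by simp
    thus ?thesis by (simp add: gauss_term_def r_def pochhammer_of_real)
  qed
  have "rGamma (w + real n) \<ge> 0" for n
    using Gamma_real_pos[of "w + real n"] assms by (simp add: rGamma_inverse_Gamma)
  hence pos: "r n \<ge> 0" for n
    using pochhammer_pos[OF assms(1), of n] pochhammer_pos[OF assms(2), of n] by (simp add: r_def)
  have "gauss_term (of_real u) (of_real v) (of_real w) sums ?V"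
    using gauss_sum[of "of_real w" "of_real u" "of_real v"] assms by simp
  moreover have "gauss_term (of_real u) (of_real v) (of_real w) = (\<lambda>n. of_real (r n))"
    by (rule ext) (rule r)
  ultimately have *: "(\<lambda>n. complex_of_real (r n)) sums ?V" by simp
  define V where "V = ?V"
  have V: "(\<lambda>n. complex_of_real (r n)) sums V" unfolding V_def by (rule *)
  from sums_Re[OF V] have rV: "r sums Re V" by simp
  have "V = of_real (Re V)"
    using V sums_of_real[OF rV, where ?'a = complex] by (rule sums_unique2)
  hence "norm V = \<bar>Re V\<bar>" by (metis norm_of_real)
  moreover have "Re V \<ge> 0"
    using suminf_nonneg[OF sums_summable[OF rV]] pos sums_unique[OF rV] by simp
  ultimately have "r sums norm V" using rV by simp
  thus ?thesis using pos by (simp add: r V_def)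
qed

text \<open>Replace \<open>a\<close> and \<open>z + m\<close> by the real numbers \<open>Re a + \<epsilon>\<close> and \<open>Re z + \<epsilon> + m\<close>.  For large \<open>m\<close> this majorises the inner
  sum up to a constant, and Gauss's theorem evaluates the majorant to a constant times \<open>rGamma (q - Re a - \<epsilon> + m)\<close>.
  What remains is a series of Gauss terms in \<open>m\<close>.  The two strict inequalities leave room for \<open>\<epsilon>\<close>.  The
  positivity of \<open>Re a\<close> keeps the majorising Pochhammer symbols positive; for \<open>Re a < 0\<close> the statement fails in general.\<close>

lemma summable_double_gauss:
  fixes a z \<alpha> \<beta> :: complex and q :: real
  assumes a: "Re a > 0" and 1: "q - Re a - Re z > 0" and 2: "q - Re a - Re (\<alpha> + \<beta>) > 0"
  shows "summable (\<lambda>m. norm (pochhammer \<alpha> m * pochhammer \<beta> m / fact m)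
           * (\<Sum>n. norm (gauss_term a (z + of_nat m) (of_real (q + real m)) n)))"
proof -
  \<comment> \<open>Room for two shifts by \<open>\<epsilon>\<close> in the first inequality and for one in the second.\<close>
  define \<epsilon> where "\<epsilon> = min (q - Re a - Re z) (q - Re a - Re (\<alpha> + \<beta>)) / 3"
  have \<epsilon>: "\<epsilon> > 0" "2 * \<epsilon> < q - Re a - Re z" "\<epsilon> < q - Re a - Re (\<alpha> + \<beta>)"
    using 1 2 unfolding \<epsilon>_def min_def by (auto simp: not_le)
  \<comment> \<open>The real substitute for \<open>a\<close>; below, \<open>v\<close> is the one for \<open>z + m\<close>.\<close>
  define u where "u = Re a + \<epsilon>"
  have u: "u > 0" using a \<epsilon> by (simp add: u_def)
  obtain C where C: "\<And>n. norm (pochhammer a n) \<le> C * pochhammer u n"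
    using norm_pochhammer_le[OF a \<epsilon>(1)] unfolding u_def by blast
  have "C \<ge> 0" using C[of 0] by (simp add: order.trans[OF zero_le_one])
  obtain J where J: "\<And>j. j \<ge> J \<Longrightarrow> norm (z + of_nat j) \<le> Re z + \<epsilon> + real j" "\<And>j. j \<ge> J \<Longrightarrow> Re z + real j > 0"
    using norm_add_nat_le_eventually[OF \<epsilon>(1), of z] by blast
  define K where "K = norm (Gamma (of_real (q - u - (Re z + \<epsilon>))) * rGamma (of_real (q - (Re z + \<epsilon>))) :: complex)"
  have bound: "(\<Sum>n. norm (gauss_term a (z + of_nat m) (of_real (q + real m)) n))
       \<le> C * K * norm (rGamma (of_real (q - u) + of_nat m) :: complex)" if m: "m \<ge> J" for m
  proof -
    define v where "v = Re z + \<epsilon> + real m"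
    have v: "v > 0" using J(2)[OF m] \<epsilon> by (simp add: v_def)
    have w: "q + real m > 0" "q + real m - u - v > 0"
      using \<epsilon> v u by (auto simp: u_def v_def)
    have le: "norm (pochhammer (z + of_nat m) n) \<le> pochhammer v n" for n
      unfolding pochhammer_prod prod_norm[symmetric]
    proof (intro prod_mono conjI norm_ge_zero)
      fix i assume "i \<in> {0..<n}"
      show "norm (z + of_nat m + of_nat i) \<le> v + of_nat i"
        using J(1)[of "m + i"] m by (simp add: v_def add_ac)
    qed
    note G = gauss_sum_real[OF u v w]
    have "norm (gauss_term a (z + of_nat m) (of_real (q + real m)) n)
        \<le> C * norm (gauss_term (of_real u) (of_real v) (of_real (q + real m)) n)" for n
    proof -
      have "norm (gauss_term a (z + of_nat m) (of_real (q + real m)) n)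
         = norm (pochhammer a n) * norm (pochhammer (z + of_nat m) n) * norm (rGamma (of_real (q + real m) + of_nat n) / fact n :: complex)"
        by (simp add: gauss_term_def norm_mult norm_divide)
      also have "\<dots> \<le> (C * pochhammer u n) * pochhammer v n * norm (rGamma (of_real (q + real m) + of_nat n) / fact n :: complex)"
        using pochhammer_pos[OF u, of n] pochhammer_pos[OF v, of n] \<open>C \<ge> 0\<close> by (intro mult_mono mult_nonneg_nonneg C le) auto
      also have "\<dots> = C * norm (gauss_term (of_real u) (of_real v) (of_real (q + real m)) n)"
        using pochhammer_pos[OF u, of n] pochhammer_pos[OF v, of n]
        by (simp add: gauss_term_def norm_mult norm_divide pochhammer_of_real)
      finally show ?thesis .
    qed
    hence "(\<Sum>n. norm (gauss_term a (z + of_nat m) (of_real (q + real m)) n))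
        \<le> (\<Sum>n. C * norm (gauss_term (of_real u) (of_real v) (of_real (q + real m)) n))"
      using w 1 by (intro suminf_le summable_norm_gauss_term summable_mult) auto
    also have "\<dots> = C * norm (Gamma (of_real (q + real m - u - v)) * rGamma (of_real (q + real m - u)) * rGamma (of_real (q + real m - v)) :: complex)"
      using G by (simp add: sums_iff suminf_mult)
    also have "\<dots> = C * K * norm (rGamma (of_real (q - u) + of_nat m) :: complex)"
    proof -
      have "q + real m - u - v = q - u - (Re z + \<epsilon>)" "q + real m - v = q - (Re z + \<epsilon>)"
        "complex_of_real (q + real m - u) = of_real (q - u) + of_nat m"
        by (simp_all add: v_def)
      thus ?thesis unfolding K_def norm_mult by (simp only: mult_ac)
    qed
    finally show ?thesis .
  qed
  have "summable (\<lambda>m. C * K * norm (gauss_term \<alpha> \<beta> (of_real (q - u)) m))"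
    by (intro summable_mult summable_norm_gauss_term) (use \<epsilon> in \<open>simp add: u_def\<close>)
  moreover have "eventually (\<lambda>m. norm (norm (pochhammer \<alpha> m * pochhammer \<beta> m / fact m)
           * (\<Sum>n. norm (gauss_term a (z + of_nat m) (of_real (q + real m)) n)))
       \<le> C * K * norm (gauss_term \<alpha> \<beta> (of_real (q - u)) m)) sequentially"
    using eventually_ge_at_top[of J]
  proof eventually_elim
    case (elim m)
    have "summable (\<lambda>n. norm (gauss_term a (z + of_nat m) (of_real (q + real m)) n))"
      using 1 by (intro summable_norm_gauss_term) auto
    hence "(\<Sum>n. norm (gauss_term a (z + of_nat m) (of_real (q + real m)) n)) \<ge> 0"
      by (rule suminf_nonneg) auto
    hence "norm (norm (pochhammer \<alpha> m * pochhammer \<beta> m / fact m)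
           * (\<Sum>n. norm (gauss_term a (z + of_nat m) (of_real (q + real m)) n)))
        = norm (pochhammer \<alpha> m * pochhammer \<beta> m / fact m)
           * (\<Sum>n. norm (gauss_term a (z + of_nat m) (of_real (q + real m)) n))"
      by simp
    also have "\<dots> \<le> norm (pochhammer \<alpha> m * pochhammer \<beta> m / fact m) * (C * K * norm (rGamma (of_real (q - u) + of_nat m) :: complex))"
      by (intro mult_left_mono bound elim) auto
    also have "\<dots> = C * K * norm (gauss_term \<alpha> \<beta> (of_real (q - u)) m)"
      unfolding gauss_term_def norm_mult[of "_ / _"] by (simp only: mult_ac)
    finally show ?case .
  qed
  ultimately show ?thesis by (rule summable_comparison_test_ev[rotated])
qed

section \<open>The integral of Appell's function against a power\<close>

definition appell_term ::
  "complex \<Rightarrow> complex \<Rightarrow> complex \<Rightarrow> complex \<Rightarrow> complex \<Rightarrow> complex \<Rightarrow> complex \<Rightarrow> nat \<Rightarrow> complex" where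
  "appell_term \<alpha> a \<beta> b \<gamma> u v m = pochhammer \<alpha> m * pochhammer \<beta> m / (pochhammer \<gamma> m * fact m) * u ^ m
            * hyp2F1 a b (\<gamma> + of_nat m) v"

lemma appell_F3_eq: "appell_F3 \<alpha> a \<beta> b \<gamma> u v = (\<Sum>m. appell_term \<alpha> a \<beta> b \<gamma> u v m)"
  by (simp add: appell_F3_def appell_term_def)

text \<open>The integrand of the operator for \<open>f t = t powr (\<rho> - 1)\<close>, with \<open>\<delta> = 1 - \<rho> + \<alpha> - \<gamma>\<close> in place of \<open>\<rho>\<close>.  In
  this parametrisation the shift \<open>\<gamma> \<mapsto> \<gamma> + 1\<close>, \<open>\<delta> \<mapsto> \<delta> - 1\<close> leaves the power of \<open>t\<close> unchanged.\<close>

definition appell_kernel ::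
  "complex \<Rightarrow> complex \<Rightarrow> complex \<Rightarrow> complex \<Rightarrow> complex \<Rightarrow> complex \<Rightarrow> real \<Rightarrow> real \<Rightarrow> complex" where
  "appell_kernel \<alpha> a \<beta> b \<gamma> \<delta> x t = of_real (t - x) powr (\<gamma> - 1) * of_real t powr (- \<gamma> - \<delta>)
     * appell_F3 \<alpha> a \<beta> b \<gamma> (of_real (1 - x / t)) (of_real (1 - t / x))"

text \<open>The summability is part of the induction hypothesis: a contiguous relation between the terms of two
  series passes to their sums only where these converge.\<close>

definition appell_integral_law ::
  "complex \<Rightarrow> complex \<Rightarrow> complex \<Rightarrow> complex \<Rightarrow> complex \<Rightarrow> complex \<Rightarrow> real \<Rightarrow> bool" where
  "appell_integral_law \<alpha> a \<beta> b \<gamma> \<delta> x \<longleftrightarrow>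
     (AE t in restrict_space lborel {x<..}.
        summable (appell_term \<alpha> a \<beta> b \<gamma> (of_real (1 - x / t)) (of_real (1 - t / x)))) \<and>
     integrable (restrict_space lborel {x<..}) (appell_kernel \<alpha> a \<beta> b \<gamma> \<delta> x) \<and>
     (\<integral>t. appell_kernel \<alpha> a \<beta> b \<gamma> \<delta> x t \<partial>restrict_space lborel {x<..}) =
       of_real x powr (- \<delta>) * Gamma \<gamma> * Gamma (a + \<delta>) * Gamma (b + \<delta>) * rGamma (a + b + \<delta>)
       * (Gamma (\<gamma> + \<delta> - \<alpha> - \<beta>) * rGamma (\<gamma> + \<delta> - \<alpha>) * rGamma (\<gamma> + \<delta> - \<beta>))"

lemma appell_kernel_measurable:
  assumes \<gamma>: "Re \<gamma> > 0" and x: "x > 0"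
  shows "appell_kernel \<alpha> a \<beta> b \<gamma> \<delta> x \<in> borel_measurable (restrict_space lborel {x<..})"
proof -
  let ?M = "restrict_space lborel {x<..}"
  have hyp: "(\<lambda>t. hyp2F1 a b (\<gamma> + of_nat m) (of_real (1 - t / x))) \<in> borel_measurable ?M" for m
  proof -
    have "Re (\<gamma> + of_nat m) > 0" using \<gamma> by (simp add: add_pos_nonneg)
    from hyp2F1_branch(1)[OF this, of a b]
    have "continuous_on slit_plane (hyp2F1 a b (\<gamma> + of_nat m))"
      by (intro holomorphic_on_imp_continuous_on) (simp add: gauss_branch_def)
    hence "continuous_on {x<..} (\<lambda>t. hyp2F1 a b (\<gamma> + of_nat m) (of_real (1 - t / x)))"
    proof (rule continuous_on_compose2)
      show "(\<lambda>t. complex_of_real (1 - t / x)) ` {x<..} \<subseteq> slit_plane"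
      proof
        fix z assume "z \<in> (\<lambda>t. complex_of_real (1 - t / x)) ` {x<..}"
        then obtain t where t: "t > x" "z = of_real (1 - t / x)" by auto
        hence "Re z < 1" using x by simp
        thus "z \<in> slit_plane" unfolding slit_plane_iff by simp
      qed
    qed (use x in \<open>auto intro!: continuous_intros\<close>)
    from borel_measurable_continuous_on_restrict[OF this] show ?thesis
      by (simp cong: measurable_cong_sets sets_restrict_space_cong)
  qed
  have [measurable]: "(\<lambda>t. t) \<in> borel_measurable ?M"
    by (rule measurable_restrict_space1) simp
  note [measurable] = hyp
  show ?thesis
    unfolding appell_kernel_def appell_F3_def by measurable
qed

text \<open>The absolutely convergent case.  The factor \<open>(1 - x / t) ^ m\<close> shifts \<open>\<gamma>\<close> to \<open>\<gamma> + m\<close> in the kernel, so that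
  each term is an integral of a single Gauss function; the sum over \<open>m\<close> is a Gauss sum with
  parameters \<open>\<alpha>\<close>, \<open>\<beta>\<close>, \<open>\<gamma> + \<delta>\<close>.\<close>

lemma appell_integral_law_base:
  assumes \<gamma>: "Re \<gamma> > 0" and a: "Re a > 0" "Re (a + \<delta>) > 0" and b: "Re (b + \<delta>) > 0"
    and \<alpha>\<beta>: "Re (\<gamma> + \<delta> - \<alpha> - \<beta>) > 0" and x: "x > 0"
  shows "appell_integral_law \<alpha> a \<beta> b \<gamma> \<delta> x"
proof -
  let ?M = "restrict_space lborel {x<..}"
  define P where "P t = complex_of_real (t - x) powr (\<gamma> - 1) * of_real t powr (- \<gamma> - \<delta>)" for t
  define T where "T t = appell_term \<alpha> a \<beta> b \<gamma> (of_real (1 - x / t)) (of_real (1 - t / x))" for t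
  define h where "h m t = complex_of_real (t - x) powr (\<gamma> + of_nat m - 1) * of_real t powr (- (\<gamma> + of_nat m) - \<delta>)
     * hyp2F1 a b (\<gamma> + of_nat m) (of_real (1 - t / x))" for m t
  define w where "w m = pochhammer \<alpha> m * pochhammer \<beta> m / (pochhammer \<gamma> m * fact m)" for m
  define f where "f m t = w m * h m t" for m t
  define q where "q = Re (\<gamma> + a + \<delta>)"
  define S where "S m = (\<Sum>n. norm (gauss_term a (\<gamma> - b + of_nat m) (of_real (q + real m)) n))" for m
  define C where "C = x powr (- Re \<delta>) * Gamma (Re \<gamma>) * Gamma (Re (a + \<delta>))"
  have \<gamma>m: "Re (\<gamma> + of_nat m) > 0" for m using \<gamma> by (simp add: add_pos_nonneg)
  note I = integral_hyp2F1[OF \<gamma>m a(2) b x, folded h_def]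
  have f_eq: "f m t = P t * T t m" if "t \<in> space ?M" for m t
  proof -
    have t: "t - x > 0" "t > 0" using that x by (auto simp: space_restrict_space)
    have "complex_of_real (t - x) powr (\<gamma> + of_nat m - 1) = of_real (t - x) powr (\<gamma> - 1) * of_real (t - x) ^ m"
      using of_real_powr_shift(1)[OF t(1), of "\<gamma> - 1" m] by (simp only: diff_add_eq)
    moreover have "complex_of_real t powr (- (\<gamma> + of_nat m) - \<delta>) = of_real t powr (- \<gamma> - \<delta>) / of_real t ^ m"
    proof -
      have "- (\<gamma> + of_nat m) - \<delta> = (- \<gamma> - \<delta>) - of_nat m" by simp
      thus ?thesis using of_real_powr_shift(2)[OF t(2), of "- \<gamma> - \<delta>" m] by (simp only:)
    qed
    moreover have "of_real (1 - x / t) ^ m = complex_of_real (t - x) ^ m / of_real t ^ m"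
    proof -
      have "complex_of_real (1 - x / t) = of_real (t - x) / of_real t" using t by (simp add: field_simps)
      thus ?thesis by (simp only: power_divide)
    qed
    ultimately show ?thesis
      unfolding f_def h_def P_def T_def appell_term_def w_def by simp
  qed
  have f_int: "integrable ?M (f m)" for m
    unfolding f_def by (intro integrable_mult_right I(1))
  have f_val: "integral\<^sup>L ?M (f m) = of_real x powr (- \<delta>) * Gamma \<gamma> * Gamma (a + \<delta>) * Gamma (b + \<delta>) * rGamma (a + b + \<delta>)
      * gauss_term \<alpha> \<beta> (\<gamma> + \<delta>) m" for m
  proof -
    have nz: "rGamma \<gamma> \<noteq> 0" "rGamma (\<gamma> + of_nat m) \<noteq> 0"
      using not_nonpos_Int_if_Re_pos[OF \<gamma>] not_nonpos_Int_if_Re_pos[OF \<gamma>m] by (simp_all add: rGamma_eq_zero_iff)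
    have "Gamma (\<gamma> + of_nat m) = Gamma \<gamma> * pochhammer \<gamma> m"
      using pochhammer_rGamma[of \<gamma> m] nz by (simp add: Gamma_def field_simps)
    hence G: "w m * Gamma (\<gamma> + of_nat m) = Gamma \<gamma> * (pochhammer \<alpha> m * pochhammer \<beta> m / fact m)"
      using pochhammer_nz[OF \<gamma>, of m] by (simp add: w_def)
    have "integral\<^sup>L ?M (f m) = w m * (of_real x powr (- \<delta>) * Gamma (\<gamma> + of_nat m) * Gamma (a + \<delta>) * Gamma (b + \<delta>)
            * rGamma (a + b + \<delta>) * rGamma (\<gamma> + of_nat m + \<delta>))"
      unfolding f_def integral_mult_right_zero I(2) ..
    also have "\<dots> = of_real x powr (- \<delta>) * (w m * Gamma (\<gamma> + of_nat m)) * Gamma (a + \<delta>) * Gamma (b + \<delta>)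
            * rGamma (a + b + \<delta>) * rGamma (\<gamma> + of_nat m + \<delta>)"
      by simp
    also have "\<dots> = of_real x powr (- \<delta>) * Gamma \<gamma> * Gamma (a + \<delta>) * Gamma (b + \<delta>) * rGamma (a + b + \<delta>)
      * gauss_term \<alpha> \<beta> (\<gamma> + \<delta>) m"
    proof -
      have "\<gamma> + of_nat m + \<delta> = \<gamma> + \<delta> + of_nat m" by simp
      thus ?thesis unfolding G gauss_term_def by (simp only: mult_ac)
    qed
    finally show ?thesis .
  qed
  have f_norm: "(\<integral>t. norm (f m t) \<partial>?M) \<le> C * (norm (pochhammer \<alpha> m * pochhammer \<beta> m / fact m) * S m)" for m
  proof -
    have S: "S m \<ge> 0" unfolding S_def
      by (intro suminf_nonneg summable_norm_gauss_term) (use b in \<open>simp_all add: q_def\<close>)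
    have arg: "\<gamma> + of_nat m - b = \<gamma> - b + of_nat m" "Re (\<gamma> + of_nat m + a + \<delta>) = q + real m"
      by (simp_all add: q_def)
    have "(\<integral>t. norm (f m t) \<partial>?M) = norm (w m) * (\<integral>t. norm (h m t) \<partial>?M)"
      unfolding f_def norm_mult by simp
    also have "\<dots> \<le> norm (w m) * (x powr (- Re \<delta>) * Gamma (Re (\<gamma> + of_nat m)) * Gamma (Re (a + \<delta>)) * S m)"
      using I(3)[of m] unfolding arg S_def by (intro mult_left_mono) auto
    also have "\<dots> = x powr (- Re \<delta>) * Gamma (Re (a + \<delta>)) * (norm (pochhammer \<alpha> m * pochhammer \<beta> m / fact m) * S m)
         * (Gamma (Re \<gamma> + real m) / norm (pochhammer \<gamma> m))"
      by (simp add: w_def norm_mult norm_divide mult_ac)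
    also have "\<dots> \<le> x powr (- Re \<delta>) * Gamma (Re (a + \<delta>)) * (norm (pochhammer \<alpha> m * pochhammer \<beta> m / fact m) * S m)
         * Gamma (Re \<gamma>)"
      using S Gamma_real_pos[OF a(2)] by (intro mult_left_mono Gamma_over_norm_pochhammer_le \<gamma> mult_nonneg_nonneg) auto
    finally show ?thesis by (simp add: C_def mult_ac)
  qed
  have "summable (\<lambda>m. norm (pochhammer \<alpha> m * pochhammer \<beta> m / fact m) * S m)"
    unfolding S_def using b \<alpha>\<beta> by (intro summable_double_gauss a(1)) (simp_all add: q_def)
  hence "summable (\<lambda>m. C * (norm (pochhammer \<alpha> m * pochhammer \<beta> m / fact m) * S m))"
    by (rule summable_mult)
  note L1 = suminf_integral_L1[OF f_int f_norm this]
  have "AE t in ?M. t \<in> space ?M" by (rule AE_space)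
  hence ae: "AE t in ?M. summable (T t)"
    using L1(1)
  proof eventually_elim
    case (elim t)
    have t: "t - x > 0" "t > 0" using elim(1) x by (auto simp: space_restrict_space)
    have nz: "P t \<noteq> 0" using t by (simp add: P_def flip: of_real_diff)
    have "summable (\<lambda>m. f m t)" using elim(2) by (rule summable_norm_cancel)
    hence "summable (\<lambda>m. P t * T t m)" using f_eq[OF elim(1)] by simp
    thus "summable (T t)" using nz by (simp add: summable_cmult_iff)
  qed
  have sum_eq: "AE t in ?M. (\<Sum>m. f m t) = appell_kernel \<alpha> a \<beta> b \<gamma> \<delta> x t"
    using \<open>AE t in ?M. t \<in> space ?M\<close> ae
  proof eventually_elim
    case (elim t)
    have "(\<Sum>m. f m t) = P t * (\<Sum>m. T t m)"
      using f_eq[OF elim(1)] suminf_mult[OF elim(2)] by simp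
    thus ?case by (simp add: appell_kernel_def appell_F3_eq P_def T_def)
  qed
  have meas: "appell_kernel \<alpha> a \<beta> b \<gamma> \<delta> x \<in> borel_measurable ?M"
    by (rule appell_kernel_measurable[OF \<gamma> x])
  have meas': "(\<lambda>t. \<Sum>m. f m t) \<in> borel_measurable ?M" using L1(2) by simp
  have int: "integrable ?M (appell_kernel \<alpha> a \<beta> b \<gamma> \<delta> x)"
    using L1(2) by (subst (asm) integrable_cong_AE[OF meas' meas sum_eq])
  have val: "(\<integral>t. (\<Sum>m. f m t) \<partial>?M) = (\<integral>t. appell_kernel \<alpha> a \<beta> b \<gamma> \<delta> x t \<partial>?M)"
    by (rule integral_cong_AE[OF meas' meas sum_eq])
  have "(\<lambda>m. integral\<^sup>L ?M (f m)) sums (of_real x powr (- \<delta>) * Gamma \<gamma> * Gamma (a + \<delta>) * Gamma (b + \<delta>) * rGamma (a + b + \<delta>)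
      * (Gamma (\<gamma> + \<delta> - \<alpha> - \<beta>) * rGamma (\<gamma> + \<delta> - \<alpha>) * rGamma (\<gamma> + \<delta> - \<beta>)))"
    unfolding f_val by (intro sums_mult gauss_sum) (use \<alpha>\<beta> in simp)
  from sums_unique2[OF L1(3) this] show ?thesis
    unfolding appell_integral_law_def val using ae[unfolded T_def] int by blast
qed

text \<open>The factor \<open>v = - (t - x) / x\<close> in the contiguous relation raises the exponent of \<open>t - x\<close> from \<open>\<gamma> - 1\<close> to \<open>\<gamma>\<close>, which
  is the exponent belonging to \<open>\<gamma> + 1\<close>.\<close>

lemma appell_integral_law_step:
  assumes \<gamma>: "Re \<gamma> > 0" and x: "x > 0" and a: "Re (a + \<delta>) > 0"
    and F: "appell_integral_law \<alpha> (a + 1) \<beta> b \<gamma> \<delta> x"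
    and G: "appell_integral_law \<alpha> (a + 1) \<beta> (b + 1) (\<gamma> + 1) (\<delta> - 1) x"
  shows "appell_integral_law \<alpha> a \<beta> b \<gamma> \<delta> x"
proof -
  let ?M = "restrict_space lborel {x<..}"
  \<comment> \<open>The coefficient of the second integrand: \<open>- (b / \<gamma>) * v = l * (t - x)\<close>.\<close>
  define l where "l = b / (\<gamma> * of_real x)"
  have \<gamma>0: "\<gamma> \<noteq> 0" using \<gamma> by auto
  have term_eq: "appell_term \<alpha> a \<beta> b \<gamma> u v m
     = appell_term \<alpha> (a + 1) \<beta> b \<gamma> u v m - b / \<gamma> * v * appell_term \<alpha> (a + 1) \<beta> (b + 1) (\<gamma> + 1) u v m"
    if v: "v \<in> slit_plane" for u v m
  proof -
    have \<gamma>m: "Re (\<gamma> + of_nat m) > 0" using \<gamma> by (simp add: add_pos_nonneg)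
    have p: "\<gamma> * pochhammer (\<gamma> + 1) m = pochhammer \<gamma> m * (\<gamma> + of_nat m)"
      using pochhammer_rec[of \<gamma> m] pochhammer_Suc[of \<gamma> m] by simp
    have "appell_term \<alpha> a \<beta> b \<gamma> u v m = appell_term \<alpha> (a + 1) \<beta> b \<gamma> u v m
       - b * v * (pochhammer \<alpha> m * pochhammer \<beta> m / (pochhammer \<gamma> m * (\<gamma> + of_nat m) * fact m)) * u ^ m
            * hyp2F1 (a + 1) (b + 1) (\<gamma> + 1 + of_nat m) v"
      unfolding appell_term_def hyp2F1_raise_a[OF \<gamma>m v, of a b]
      by (simp add: algebra_simps)
    also have "b * v * (pochhammer \<alpha> m * pochhammer \<beta> m / (pochhammer \<gamma> m * (\<gamma> + of_nat m) * fact m)) * u ^ m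
            * hyp2F1 (a + 1) (b + 1) (\<gamma> + 1 + of_nat m) v
       = b / \<gamma> * v * appell_term \<alpha> (a + 1) \<beta> (b + 1) (\<gamma> + 1) u v m"
      unfolding appell_term_def p[symmetric] by (simp add: mult_ac)
    finally show ?thesis .
  qed
  have slit: "complex_of_real (1 - t / x) \<in> slit_plane" if "t \<in> space ?M" for t
    unfolding slit_plane_iff using that x by (simp add: space_restrict_space)
  let ?A = "\<lambda>t. appell_term \<alpha> (a + 1) \<beta> b \<gamma> (of_real (1 - x / t)) (of_real (1 - t / x))"
  let ?B = "\<lambda>t. appell_term \<alpha> (a + 1) \<beta> (b + 1) (\<gamma> + 1) (of_real (1 - x / t)) (of_real (1 - t / x))"
  let ?T = "\<lambda>t. appell_term \<alpha> a \<beta> b \<gamma> (of_real (1 - x / t)) (of_real (1 - t / x))"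
  let ?K1 = "appell_kernel \<alpha> (a + 1) \<beta> b \<gamma> \<delta> x"
  let ?K2 = "appell_kernel \<alpha> (a + 1) \<beta> (b + 1) (\<gamma> + 1) (\<delta> - 1) x"
  have sA: "AE t in ?M. summable (?A t)" and sB: "AE t in ?M. summable (?B t)"
    using F G by (auto simp: appell_integral_law_def)
  have sp: "AE t in ?M. t \<in> space ?M" by (rule AE_space)
  have sT: "AE t in ?M. summable (?T t)"
    using sA sB sp
  proof eventually_elim
    case (elim t)
    have "summable (\<lambda>m. ?A t m - b / \<gamma> * of_real (1 - t / x) * ?B t m)"
      by (intro summable_diff summable_mult elim(1,2))
    thus ?case by (simp only: term_eq[OF slit[OF elim(3)], symmetric])
  qed
  have K_eq: "AE t in ?M. ?K1 t + l * ?K2 t = appell_kernel \<alpha> a \<beta> b \<gamma> \<delta> x t"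
    using sA sB sp
  proof eventually_elim
    case (elim t)
    have t: "t - x > 0" using elim(3) by (simp add: space_restrict_space)
    have "appell_F3 \<alpha> a \<beta> b \<gamma> (of_real (1 - x / t)) (of_real (1 - t / x))
        = (\<Sum>m. ?A t m - b / \<gamma> * of_real (1 - t / x) * ?B t m)"
      unfolding appell_F3_eq by (simp only: term_eq[OF slit[OF elim(3)], symmetric])
    also have "\<dots> = (\<Sum>m. ?A t m) - b / \<gamma> * of_real (1 - t / x) * (\<Sum>m. ?B t m)"
      by (rule sums_unique[symmetric]) (intro sums_diff sums_mult summable_sums elim(1,2))
    also have "b / \<gamma> * complex_of_real (1 - t / x) = - (l * of_real (t - x))"
      using x \<gamma>0 by (simp add: l_def divide_simps) (simp add: algebra_simps)
    finally have "appell_F3 \<alpha> a \<beta> b \<gamma> (of_real (1 - x / t)) (of_real (1 - t / x))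
       = (\<Sum>m. ?A t m) + l * of_real (t - x) * (\<Sum>m. ?B t m)" by simp
    moreover have "complex_of_real (t - x) powr (\<gamma> + 1 - 1) = of_real (t - x) powr (\<gamma> - 1) * of_real (t - x)"
      using of_real_powr_shift(1)[OF t, of "\<gamma> - 1" 1] by simp
    moreover have "- (\<gamma> + 1) - (\<delta> - 1) = - \<gamma> - \<delta>" by simp
    ultimately show ?case
      unfolding appell_kernel_def appell_F3_eq by (simp only:) (simp add: algebra_simps)
  qed
  have int12: "integrable ?M ?K1" "integrable ?M ?K2" using F G by (auto simp: appell_integral_law_def)
  hence int: "integrable ?M (\<lambda>t. ?K1 t + l * ?K2 t)" by simp
  have meas: "appell_kernel \<alpha> a \<beta> b \<gamma> \<delta> x \<in> borel_measurable ?M"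
    by (rule appell_kernel_measurable[OF \<gamma> x])
  have intK: "integrable ?M (appell_kernel \<alpha> a \<beta> b \<gamma> \<delta> x)"
    using int by (subst (asm) integrable_cong_AE[OF borel_measurable_integrable[OF int] meas K_eq])
  define R where "R = Gamma (\<gamma> + \<delta> - \<alpha> - \<beta>) * rGamma (\<gamma> + \<delta> - \<alpha>) * rGamma (\<gamma> + \<delta> - \<beta>)"
  have "(\<integral>t. appell_kernel \<alpha> a \<beta> b \<gamma> \<delta> x t \<partial>?M) = integral\<^sup>L ?M ?K1 + l * integral\<^sup>L ?M ?K2"
    using integral_cong_AE[OF borel_measurable_integrable[OF int] meas K_eq] int12 by simp
  also have "integral\<^sup>L ?M ?K1 = of_real x powr (- \<delta>) * Gamma \<gamma> * Gamma (a + 1 + \<delta>) * Gamma (b + \<delta>) * rGamma (a + 1 + b + \<delta>) * R"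
    using F by (simp add: appell_integral_law_def R_def)
  also have "integral\<^sup>L ?M ?K2 = of_real x powr (1 - \<delta>) * Gamma (\<gamma> + 1) * Gamma (a + \<delta>) * Gamma (b + \<delta>) * rGamma (a + 1 + b + \<delta>) * R"
    using G by (simp add: appell_integral_law_def R_def algebra_simps)
  also have "of_real x powr (- \<delta>) * Gamma \<gamma> * Gamma (a + 1 + \<delta>) * Gamma (b + \<delta>) * rGamma (a + 1 + b + \<delta>) * R
     + l * (of_real x powr (1 - \<delta>) * Gamma (\<gamma> + 1) * Gamma (a + \<delta>) * Gamma (b + \<delta>) * rGamma (a + 1 + b + \<delta>) * R)
     = of_real x powr (- \<delta>) * Gamma \<gamma> * Gamma (a + \<delta>) * Gamma (b + \<delta>) * rGamma (a + b + \<delta>) * R"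
  proof -
    have "Gamma (a + \<delta> + 1) = (a + \<delta>) * Gamma (a + \<delta>)"
      by (rule Gamma_plus1) (rule not_nonpos_Int_if_Re_pos[OF a])
    hence 1: "Gamma (a + 1 + \<delta>) = (a + \<delta>) * Gamma (a + \<delta>)" by (simp add: add_ac)
    have 2: "Gamma (\<gamma> + 1) = \<gamma> * Gamma \<gamma>"
      by (rule Gamma_plus1) (rule not_nonpos_Int_if_Re_pos[OF \<gamma>])
    have 3: "complex_of_real x powr (1 - \<delta>) = of_real x * of_real x powr (- \<delta>)"
      using of_real_powr_shift(1)[OF x, of "- \<delta>" 1] by (simp add: mult.commute)
    have 4: "rGamma (a + b + \<delta>) = (a + b + \<delta>) * rGamma (a + 1 + b + \<delta>)"
      using rGamma_plus1[of "a + b + \<delta>"] by (simp add: add_ac)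
    show ?thesis unfolding 1 2 3 4 l_def using \<gamma>0 x by (simp add: algebra_simps)
  qed
  finally show ?thesis
    using sT intK unfolding appell_integral_law_def R_def by blast
qed

text \<open>Descent in \<open>Re a\<close>: the step preserves \<open>\<gamma> + \<delta>\<close>, and \<open>Re (a + \<delta>)\<close> and \<open>Re (b + \<delta>)\<close> do not decrease.\<close>

theorem appell_integral:
  assumes \<gamma>: "Re \<gamma> > 0" and a: "Re (a + \<delta>) > 0" and b: "Re (b + \<delta>) > 0"
    and \<alpha>\<beta>: "Re (\<gamma> + \<delta> - \<alpha> - \<beta>) > 0" and x: "x > 0"
  shows "appell_integral_law \<alpha> a \<beta> b \<gamma> \<delta> x"
proof -
  have *: "appell_integral_law \<alpha> a \<beta> b \<gamma> \<delta> x"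
    if "Re a > - real N" "Re \<gamma> > 0" "Re (a + \<delta>) > 0" "Re (b + \<delta>) > 0" "Re (\<gamma> + \<delta> - \<alpha> - \<beta>) > 0" for N a b \<gamma> \<delta>
    using that
  proof (induction N arbitrary: a b \<gamma> \<delta>)
    case 0
    thus ?case by (intro appell_integral_law_base x) auto
  next
    case (Suc N)
    have "appell_integral_law \<alpha> (a + 1) \<beta> b \<gamma> \<delta> x"
      "appell_integral_law \<alpha> (a + 1) \<beta> (b + 1) (\<gamma> + 1) (\<delta> - 1) x"
      using Suc.prems by (auto intro!: Suc.IH)
    thus ?case by (rule appell_integral_law_step[OF Suc.prems(2) x Suc.prems(3)])
  qed
  obtain N where "- Re a < real N" using reals_Archimedean2 by blast
  hence "- real N < Re a" by simp
  from *[OF this assms(1-4)] show ?thesis .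
qed

section \<open>The generalised Bessel function\<close>

lemma summable_bessel_coeff:
  fixes \<kappa> w :: complex
  shows "summable (\<lambda>k. norm (rGamma (\<kappa> + of_nat k) / fact k * w ^ k))"
proof -
  \<comment> \<open>From \<open>N\<close> on, \<open>\<bar>rGamma (\<kappa> + k)\<bar>\<close> does not increase and the exponential factor at least halves in each step.\<close>
  obtain N where N: "norm \<kappa> + 1 + 2 * norm w < real N" using reals_Archimedean2 by blast
  show ?thesis
  proof (rule summable_ratio_test[of "1 / 2" N])
    fix k assume "k \<ge> N"
    hence k: "real N \<le> real k" by simp
    have "real k \<le> norm (\<kappa> + of_nat k) + norm \<kappa>"
      using norm_triangle_ineq4[of "\<kappa> + of_nat k" \<kappa>] by simp
    hence 1: "norm (\<kappa> + of_nat k) \<ge> 1" using N k norm_ge_zero[of w] by linarith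
    have "norm (rGamma (\<kappa> + of_nat (Suc k))) * 1 \<le> norm (rGamma (\<kappa> + of_nat (Suc k))) * norm (\<kappa> + of_nat k)"
      by (intro mult_left_mono 1) auto
    also have "\<dots> = norm (rGamma (\<kappa> + of_nat k))"
      using rGamma_plus1[of "\<kappa> + of_nat k"] by (simp add: add_ac flip: norm_mult) (simp add: mult.commute)
    finally have 2: "norm (rGamma (\<kappa> + of_nat (Suc k))) \<le> norm (rGamma (\<kappa> + of_nat k))" by simp
    have "2 * norm w \<le> real (Suc k)" using N k norm_ge_zero[of \<kappa>] by linarith
    hence 3: "norm w / real (Suc k) \<le> 1 / 2" by (simp add: field_simps)
    have "norm (rGamma (\<kappa> + of_nat (Suc k)) / fact (Suc k) * w ^ Suc k)
        = norm (rGamma (\<kappa> + of_nat (Suc k))) * (norm w / real (Suc k)) * (norm w ^ k / fact k)"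
      by (simp add: norm_mult norm_divide norm_power del: of_nat_Suc)
    also have "\<dots> \<le> norm (rGamma (\<kappa> + of_nat k)) * (1 / 2) * (norm w ^ k / fact k)"
      by (intro mult_right_mono mult_mono 2 3) auto
    finally show "norm (norm (rGamma (\<kappa> + of_nat (Suc k)) / fact (Suc k) * w ^ Suc k))
        \<le> 1 / 2 * norm (norm (rGamma (\<kappa> + of_nat k) / fact k * w ^ k))"
      by (simp add: norm_mult norm_divide norm_power)
  qed simp
qed

lemma gen_bessel_reciprocal_sums:
  fixes p b c :: complex and t :: real
  assumes t: "t > 0"
  shows "(\<lambda>k. 1 / 2 powr p * of_real t powr (- p) *
            (rGamma (p + (b + 1) / 2 + of_nat k) / fact k * (- c / (4 * of_real t ^ 2)) ^ k))
         sums gen_bessel p b c (of_real (1 / t))"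
proof -
  have eq: "(-1) ^ k * c ^ k * rGamma (p + (b + 1) / 2 + of_nat k) / fact k
            * (of_real (1 / t) / 2) powr (2 * of_nat k + p)
     = 1 / 2 powr p * of_real t powr (- p) *
            (rGamma (p + (b + 1) / 2 + of_nat k) / fact k * (- c / (4 * of_real t ^ 2)) ^ k)" for k
  proof -
    define T where "T = (1 / (4 * complex_of_real t ^ 2)) ^ k"
    have pow: "(- c / (4 * of_real t ^ 2)) ^ k = (-1) ^ k * c ^ k * T"
    proof -
      have "- c / (4 * of_real t ^ 2) = (-1) * c * (1 / (4 * complex_of_real t ^ 2))" by simp
      thus ?thesis unfolding T_def by (simp only: power_mult_distrib)
    qed
    have inv: "complex_of_real (1 / t) / 2 = of_real (1 / (2 * t))" by simp
    have "complex_of_real (1 / (2 * t)) powr (2 * of_nat k + p)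
        = of_real (1 / (2 * t)) powr p * of_real (1 / (2 * t)) ^ (2 * k)"
      using of_real_powr_shift(1)[of "1 / (2 * t)" p "2 * k"] t by (simp add: add.commute)
    also have "complex_of_real (1 / (2 * t)) powr p = 1 / 2 powr p * of_real t powr (- p)"
    proof -
      have "complex_of_real (1 / (2 * t)) powr p * of_real (2 * t) powr p
          = (of_real (1 / (2 * t)) * of_real (2 * t)) powr p"
        using t by (intro powr_times_real [symmetric]) auto
      also have "complex_of_real (1 / (2 * t)) * of_real (2 * t) = 1"
        using t by (simp flip: of_real_mult)
      finally have "complex_of_real (1 / (2 * t)) powr p * of_real (2 * t) powr p = 1" by simp
      moreover have "complex_of_real (2 * t) powr p = 2 powr p * of_real t powr p"
        unfolding of_real_mult of_real_numeral using t by (intro powr_times_real) auto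
      ultimately show ?thesis using t by (simp add: powr_minus field_simps)
    qed
    also have "complex_of_real (1 / (2 * t)) ^ (2 * k) = T"
      by (simp add: T_def power_mult power_divide power_mult_distrib power2_eq_square)
    finally show ?thesis
      unfolding inv pow by (simp only:) (simp add: mult_ac)
  qed
  have "summable (\<lambda>k. rGamma (p + (b + 1) / 2 + of_nat k) / fact k * (- c / (4 * of_real t ^ 2)) ^ k)"
    by (rule summable_norm_cancel[OF summable_bessel_coeff])
  hence "(\<lambda>k. 1 / 2 powr p * of_real t powr (- p) *
            (rGamma (p + (b + 1) / 2 + of_nat k) / fact k * (- c / (4 * of_real t ^ 2)) ^ k)) sums
     (\<Sum>k. 1 / 2 powr p * of_real t powr (- p) *
            (rGamma (p + (b + 1) / 2 + of_nat k) / fact k * (- c / (4 * of_real t ^ 2)) ^ k))"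
    by (intro summable_sums summable_mult)
  thus ?thesis unfolding gen_bessel_def eq .
qed

text \<open>The \<open>k\<close>-th power in the Bessel series replaces \<open>\<delta>\<close> by \<open>\<delta> + 2 k\<close>, that is, it divides the kernel by \<open>t ^ (2 * k)\<close>.
  The parameter \<open>\<delta>\<close> defined here belongs to the power \<open>t powr (\<rho> - p - 1)\<close>.\<close>

lemma msm_integral_bessel:
  fixes \<alpha> \<alpha>' \<beta> \<beta>' \<gamma> \<rho> p b c :: complex and x :: real
  assumes gamma: "Re \<gamma> > 0"
    and rho: "Re (\<rho> - p) < 1 + min (Re (- \<beta>)) (min (Re (\<alpha> + \<alpha>' - \<gamma>)) (Re (\<alpha> + \<beta>' - \<gamma>)))"
    and x: "x > 0"
  defines "M \<equiv> restrict_space lborel {x<..}"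
  defines "I \<equiv> msm_integrand \<alpha> \<alpha>' \<beta> \<beta>' \<gamma> (\<lambda>t. of_real t powr (\<rho> - 1) * gen_bessel p b c (of_real (1 / t))) x"
  defines "\<delta> \<equiv> 1 - \<rho> + p - \<gamma> + \<alpha>"
  shows "integrable M I"
    and "(\<lambda>k. 1 / 2 powr p * of_real x powr (- \<delta>) * Gamma \<gamma>
          * (Gamma (\<alpha>' + \<delta> + of_nat (2 * k)) * Gamma (\<beta>' + \<delta> + of_nat (2 * k)) * rGamma (\<alpha>' + \<beta>' + \<delta> + of_nat (2 * k))
          * (Gamma (\<gamma> + \<delta> + of_nat (2 * k) - \<alpha> - \<beta>) * rGamma (\<gamma> + \<delta> + of_nat (2 * k) - \<alpha>) * rGamma (\<gamma> + \<delta> + of_nat (2 * k) - \<beta>))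
          * (rGamma (p + (b + 1) / 2 + of_nat k) / fact k * (- c / (4 * of_real x ^ 2)) ^ k)))
       sums integral\<^sup>L M I"
proof -
  define \<kappa> where "\<kappa> = p + (b + 1) / 2"
  define K where "K n = appell_kernel \<alpha> \<alpha>' \<beta> \<beta>' \<gamma> (\<delta> + of_nat n) x" for n
  define e where "e k = rGamma (\<kappa> + of_nat k) / fact k" for k
  define w where "w = - c / (4 * of_real x ^ 2)"
  define f where "f k t = 1 / 2 powr p * e k * (- c / 4) ^ k * K (2 * k) t" for k t
  have cond: "Re (\<alpha>' + \<delta>) > 0" "Re (\<beta>' + \<delta>) > 0" "Re (\<gamma> + \<delta> - \<alpha> - \<beta>) > 0"
    using rho by (simp_all add: \<delta>_def min_def split: if_splits)
  have law: "appell_integral_law \<alpha> \<alpha>' \<beta> \<beta>' \<gamma> (\<delta> + of_nat n) x" for n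
    by (rule appell_integral[OF gamma _ _ _ x]) (use cond in \<open>simp_all\<close>)
  have K_int: "integrable M (K n)" for n
    using law[of n] unfolding appell_integral_law_def K_def M_def by blast
  have K_val: "integral\<^sup>L M (K n) = of_real x powr (- (\<delta> + of_nat n)) * Gamma \<gamma> * Gamma (\<alpha>' + (\<delta> + of_nat n)) * Gamma (\<beta>' + (\<delta> + of_nat n)) * rGamma (\<alpha>' + \<beta>' + (\<delta> + of_nat n))
       * (Gamma (\<gamma> + (\<delta> + of_nat n) - \<alpha> - \<beta>) * rGamma (\<gamma> + (\<delta> + of_nat n) - \<alpha>) * rGamma (\<gamma> + (\<delta> + of_nat n) - \<beta>))" for n
    using law[of n] unfolding appell_integral_law_def K_def M_def by blast
  have sp: "t > x" "t > 0" if "t \<in> space M" for t using that x by (auto simp: M_def space_restrict_space)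
  have K_shift: "K n t = K 0 t / of_real t ^ n" if "t > 0" for n t
  proof -
    have "- \<gamma> - (\<delta> + of_nat n) = (- \<gamma> - \<delta>) - of_nat n" by simp
    hence "complex_of_real t powr (- \<gamma> - (\<delta> + of_nat n)) = of_real t powr (- \<gamma> - \<delta>) / of_real t ^ n"
      using of_real_powr_shift(2)[OF that, of "- \<gamma> - \<delta>" n] by (simp only:)
    thus ?thesis by (simp add: K_def appell_kernel_def)
  qed
  have f_int: "integrable M (f k)" for k
    unfolding f_def by (intro integrable_mult_right K_int)
  have pow: "(- c / (4 * y ^ 2)) ^ k = (- c / 4) ^ k / y ^ (2 * k)" for y :: complex and k
  proof -
    have "- c / (4 * y ^ 2) = (- c / 4) / y ^ 2" by simp
    thus ?thesis by (simp only: power_divide power_mult)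
  qed
  have f_norm: "(\<integral>t. norm (f k t) \<partial>M) \<le> norm (1 / 2 powr p) * norm (e k * w ^ k) * (\<integral>t. norm (K 0 t) \<partial>M)" for k
  proof -
    have "(\<integral>t. norm (f k t) \<partial>M) \<le> (\<integral>t. norm (1 / 2 powr p) * norm (e k * w ^ k) * norm (K 0 t) \<partial>M)"
    proof (rule integral_mono)
      show "integrable M (\<lambda>t. norm (f k t))" using f_int by (rule integrable_norm)
      show "integrable M (\<lambda>t. norm (1 / 2 powr p) * norm (e k * w ^ k) * norm (K 0 t))"
        by (intro integrable_mult_right integrable_norm K_int)
      fix t assume t: "t \<in> space M"
      have "norm (K (2 * k) t) = norm (K 0 t) / t ^ (2 * k)"
        using sp[OF t] by (simp add: K_shift[of t "2 * k"] norm_divide norm_power)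
      also have "\<dots> \<le> norm (K 0 t) / x ^ (2 * k)"
        using sp[OF t] x by (intro divide_left_mono power_mono) auto
      finally have "norm (f k t) \<le> norm (1 / 2 powr p) * norm (e k) * norm (- c / 4) ^ k * (norm (K 0 t) / x ^ (2 * k))"
        unfolding f_def norm_mult norm_power by (intro mult_left_mono) auto
      also have "\<dots> = norm (1 / 2 powr p) * norm (e k * w ^ k) * norm (K 0 t)"
        using x by (simp add: w_def norm_mult norm_divide norm_power power_divide power_mult_distrib flip: power_mult)
      finally show "norm (f k t) \<le> norm (1 / 2 powr p) * norm (e k * w ^ k) * norm (K 0 t)" .
    qed
    thus ?thesis by simp
  qed
  have "summable (\<lambda>k. norm (1 / 2 powr p) * norm (e k * w ^ k) * (\<integral>t. norm (K 0 t) \<partial>M))"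
    unfolding e_def by (intro summable_mult2 summable_mult summable_bessel_coeff)
  note L1 = suminf_integral_L1[OF f_int f_norm this]
  have sum_eq: "(\<Sum>k. f k t) = I t" if t: "t \<in> space M" for t
  proof -
    define P where "P = of_real (t - x) powr (\<gamma> - 1) * of_real t powr (- \<alpha>)
       * appell_F3 \<alpha> \<alpha>' \<beta> \<beta>' \<gamma> (of_real (1 - x / t)) (of_real (1 - t / x)) * complex_of_real t powr (\<rho> - 1)"
    have "(\<lambda>k. P * (1 / 2 powr p * of_real t powr (- p) * (e k * (- c / (4 * of_real t ^ 2)) ^ k))) sums
        (P * gen_bessel p b c (of_real (1 / t)))"
      unfolding e_def \<kappa>_def by (intro sums_mult gen_bessel_reciprocal_sums sp(2)[OF t])
    also have "(\<lambda>k. P * (1 / 2 powr p * of_real t powr (- p) * (e k * (- c / (4 * of_real t ^ 2)) ^ k))) = (\<lambda>k. f k t)"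
    proof
      fix k
      have "P * of_real t powr (- p) = K 0 t"
      proof -
        have "- \<gamma> - \<delta> = - \<alpha> + (\<rho> - 1) + - p" by (simp add: \<delta>_def)
        hence "complex_of_real t powr (- \<gamma> - \<delta>) = of_real t powr (- \<alpha>) * of_real t powr (\<rho> - 1) * of_real t powr (- p)"
          by (simp only: powr_add)
        thus ?thesis by (simp add: K_def appell_kernel_def P_def)
      qed
      moreover note pow[of "of_real t" k]
      ultimately show "P * (1 / 2 powr p * of_real t powr (- p) * (e k * (- c / (4 * of_real t ^ 2)) ^ k)) = f k t"
        unfolding f_def K_shift[OF sp(2)[OF t], of "2 * k"] by (simp add: mult_ac)
    qed
    finally show ?thesis by (simp add: sums_iff I_def msm_integrand_def P_def mult_ac)
  qed
  have eq: "integrable M (\<lambda>t. \<Sum>k. f k t) = integrable M I"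
    "(\<integral>t. (\<Sum>k. f k t) \<partial>M) = integral\<^sup>L M I"
    by (intro Bochner_Integration.integrable_cong Bochner_Integration.integral_cong refl sum_eq; assumption)+
  show "integrable M I" using L1(2) unfolding eq .
  have f_val: "integral\<^sup>L M (f k) = 1 / 2 powr p * of_real x powr (- \<delta>) * Gamma \<gamma>
          * (Gamma (\<alpha>' + \<delta> + of_nat (2 * k)) * Gamma (\<beta>' + \<delta> + of_nat (2 * k)) * rGamma (\<alpha>' + \<beta>' + \<delta> + of_nat (2 * k))
          * (Gamma (\<gamma> + \<delta> + of_nat (2 * k) - \<alpha> - \<beta>) * rGamma (\<gamma> + \<delta> + of_nat (2 * k) - \<alpha>) * rGamma (\<gamma> + \<delta> + of_nat (2 * k) - \<beta>))
          * (e k * w ^ k))" for k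
  proof -
    have "- (\<delta> + of_nat (2 * k)) = - \<delta> - of_nat (2 * k)" by simp
    hence xs: "complex_of_real x powr (- (\<delta> + of_nat (2 * k))) = of_real x powr (- \<delta>) / of_real x ^ (2 * k)"
      using of_real_powr_shift(2)[OF x, of "- \<delta>" "2 * k"] by (simp only:)
    have wk: "w ^ k = (- c / 4) ^ k / of_real x ^ (2 * k)"
      unfolding w_def by (rule pow)
    have "integral\<^sup>L M (f k) = 1 / 2 powr p * e k * (- c / 4) ^ k * integral\<^sup>L M (K (2 * k))"
      unfolding f_def by (rule integral_mult_right_zero)
    thus ?thesis unfolding K_val xs wk add.assoc[symmetric] by (simp add: mult_ac)
  qed
  show "(\<lambda>k. 1 / 2 powr p * of_real x powr (- \<delta>) * Gamma \<gamma>
          * (Gamma (\<alpha>' + \<delta> + of_nat (2 * k)) * Gamma (\<beta>' + \<delta> + of_nat (2 * k)) * rGamma (\<alpha>' + \<beta>' + \<delta> + of_nat (2 * k))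
          * (Gamma (\<gamma> + \<delta> + of_nat (2 * k) - \<alpha> - \<beta>) * rGamma (\<gamma> + \<delta> + of_nat (2 * k) - \<alpha>) * rGamma (\<gamma> + \<delta> + of_nat (2 * k) - \<beta>))
          * (rGamma (p + (b + 1) / 2 + of_nat k) / fact k * (- c / (4 * of_real x ^ 2)) ^ k)))
       sums integral\<^sup>L M I"
    using L1(3) unfolding f_val eq e_def \<kappa>_def w_def .
qed

section \<open>The image of the Bessel function under the operator\<close>

theorem theorem2p2:
  fixes \<alpha> \<alpha>' \<beta> \<beta>' \<gamma> \<rho> p b c \<kappa> :: complex and x :: real
  assumes kappa_def: "\<kappa> = p + (b + 1) / 2"
    and kappa: "\<kappa> \<notin> \<int>\<^sub>\<le>\<^sub>0"
    and gamma: "Re \<gamma> > 0"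
    and rho: "Re (\<rho> - p) < 1 + min (Re (- \<beta>)) (min (Re (\<alpha> + \<alpha>' - \<gamma>)) (Re (\<alpha> + \<beta>' - \<gamma>)))"
    and x: "x > 0"
  shows
    "set_integrable lborel {x<..}
       (msm_integrand \<alpha> \<alpha>' \<beta> \<beta>' \<gamma>
          (\<lambda>t. of_real t powr (\<rho> - 1) * gen_bessel p b c (of_real (1 / t))) x)
     \<and> msm_integral \<alpha> \<alpha>' \<beta> \<beta>' \<gamma>
          (\<lambda>t. of_real t powr (\<rho> - 1) * gen_bessel p b c (of_real (1 / t))) x
       = of_real x powr (\<rho> - p - \<alpha> - \<alpha>' + \<gamma> - 1) / 2 powr p
         * wright_psi
             [(1 - \<rho> + p - \<gamma> + \<alpha> + \<alpha>', 2), (1 - \<rho> + p + \<alpha> + \<beta>' - \<gamma>, 2), (1 - \<rho> + p - \<beta>, 2)]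
             [(1 - \<rho> + p, 2), (1 - \<rho> + p - \<gamma> + \<alpha> + \<alpha>' + \<beta>', 2), (1 - \<rho> + p + \<alpha> - \<beta>, 2), (\<kappa>, 1)]
             (- c / (4 * of_real x ^ 2))"
proof
  let ?M = "restrict_space lborel {x<..}"
  let ?I = "msm_integrand \<alpha> \<alpha>' \<beta> \<beta>' \<gamma> (\<lambda>t. of_real t powr (\<rho> - 1) * gen_bessel p b c (of_real (1 / t))) x"
  let ?as = "[(1 - \<rho> + p - \<gamma> + \<alpha> + \<alpha>', 2), (1 - \<rho> + p + \<alpha> + \<beta>' - \<gamma>, 2), (1 - \<rho> + p - \<beta>, 2)]"
  let ?bs = "[(1 - \<rho> + p, 2), (1 - \<rho> + p - \<gamma> + \<alpha> + \<alpha>' + \<beta>', 2), (1 - \<rho> + p + \<alpha> - \<beta>, 2), (\<kappa>, 1)]"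
  define \<delta> where "\<delta> = 1 - \<rho> + p - \<gamma> + \<alpha>"
  define z where "z = - c / (4 * complex_of_real x ^ 2)"
  define W where "W k = (\<Prod>(a, A)\<leftarrow>?as. Gamma (a + of_real A * of_nat k))
            * (\<Prod>(b, B)\<leftarrow>?bs. rGamma (b + of_real B * of_nat k)) * z ^ k / fact k" for k
  define C where "C = of_real x powr (- \<delta>) * Gamma \<gamma> / 2 powr p"
  note bessel = msm_integral_bessel[OF gamma rho x, where b = b and c = c, folded \<delta>_def z_def]
  show "set_integrable lborel {x<..} ?I"
    using bessel(1) unfolding set_integrable_def by (subst (asm) integrable_restrict_space) auto
  have term_eq: "1 / 2 powr p * of_real x powr (- \<delta>) * Gamma \<gamma>
          * (Gamma (\<alpha>' + \<delta> + of_nat (2 * k)) * Gamma (\<beta>' + \<delta> + of_nat (2 * k)) * rGamma (\<alpha>' + \<beta>' + \<delta> + of_nat (2 * k))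
          * (Gamma (\<gamma> + \<delta> + of_nat (2 * k) - \<alpha> - \<beta>) * rGamma (\<gamma> + \<delta> + of_nat (2 * k) - \<alpha>) * rGamma (\<gamma> + \<delta> + of_nat (2 * k) - \<beta>))
          * (rGamma (p + (b + 1) / 2 + of_nat k) / fact k * z ^ k)) = C * W k" for k
  proof -
    have "1 - \<rho> + p - \<gamma> + \<alpha> + \<alpha>' + of_real 2 * of_nat k = \<alpha>' + \<delta> + of_nat (2 * k)"
      "1 - \<rho> + p + \<alpha> + \<beta>' - \<gamma> + of_real 2 * of_nat k = \<beta>' + \<delta> + of_nat (2 * k)"
      "1 - \<rho> + p - \<beta> + of_real 2 * of_nat k = \<gamma> + \<delta> + of_nat (2 * k) - \<alpha> - \<beta>"
      "1 - \<rho> + p + of_real 2 * of_nat k = \<gamma> + \<delta> + of_nat (2 * k) - \<alpha>"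
      "1 - \<rho> + p - \<gamma> + \<alpha> + \<alpha>' + \<beta>' + of_real 2 * of_nat k = \<alpha>' + \<beta>' + \<delta> + of_nat (2 * k)"
      "1 - \<rho> + p + \<alpha> - \<beta> + of_real 2 * of_nat k = \<gamma> + \<delta> + of_nat (2 * k) - \<beta>"
      "\<kappa> + of_real 1 * of_nat k = p + (b + 1) / 2 + of_nat k"
      by (simp_all add: \<delta>_def kappa_def)
    note args = this
    show ?thesis
      unfolding C_def W_def list.map prod_list.Cons prod_list.Nil prod.case args
      by (simp only: mult_1_right mult_1_left times_divide_eq_left times_divide_eq_right mult_ac)
  qed
  have nz: "C \<noteq> 0"
    using x not_nonpos_Int_if_Re_pos[OF gamma] by (simp add: C_def Gamma_eq_zero_iff)
  have "(\<lambda>k. C * W k) sums integral\<^sup>L ?M ?I"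
    using bessel(2) unfolding term_eq .
  moreover from this have "summable W"
    using nz sums_summable summable_cmult_iff by blast
  ultimately have "integral\<^sup>L ?M ?I = C * (\<Sum>k. W k)"
    by (simp add: sums_iff suminf_mult)
  also have "(\<Sum>k. W k) = wright_psi ?as ?bs z"
    unfolding wright_psi_def W_def ..
  finally have "msm_integral \<alpha> \<alpha>' \<beta> \<beta>' \<gamma>
          (\<lambda>t. of_real t powr (\<rho> - 1) * gen_bessel p b c (of_real (1 / t))) x
      = of_real x powr (- \<alpha>') / Gamma \<gamma> * (C * wright_psi ?as ?bs z)"
    by (simp add: msm_integral_def set_lebesgue_integral_def integral_restrict_space)
  also have "\<dots> = (of_real x powr (- \<alpha>') * of_real x powr (- \<delta>)) / 2 powr p * wright_psi ?as ?bs z"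
    using not_nonpos_Int_if_Re_pos[OF gamma] by (simp add: C_def Gamma_eq_zero_iff)
  also have "complex_of_real x powr (- \<alpha>') * of_real x powr (- \<delta>) = of_real x powr (\<rho> - p - \<alpha> - \<alpha>' + \<gamma> - 1)"
  proof -
    have "- \<alpha>' + - \<delta> = \<rho> - p - \<alpha> - \<alpha>' + \<gamma> - 1" by (simp add: \<delta>_def)
    thus ?thesis by (simp only: powr_add[symmetric])
  qed
  finally show "msm_integral \<alpha> \<alpha>' \<beta> \<beta>' \<gamma>
          (\<lambda>t. of_real t powr (\<rho> - 1) * gen_bessel p b c (of_real (1 / t))) x
       = of_real x powr (\<rho> - p - \<alpha> - \<alpha>' + \<gamma> - 1) / 2 powr p * wright_psi ?as ?bs (- c / (4 * of_real x ^ 2))"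
    unfolding z_def .
qed

end
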